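(* Let $K$ be a field, $S=K[x_1,\ldots,x_n]$ the polynomial ring in $n$ variables, and let $N$ be a (nonzero) finitely generated graded Cohen-Macaulay $S$-module of codimension $s$ with pure resolution of type $(d_0,d_1,\ldots,d_s)$ with $d_0=0$, i.e. whose minimal graded free $S$-resolution has the form $$0\to S^{\beta_s}(-d_s)\to\cdots\to S^{\beta_1}(-d_1)\to S^{\beta_0}(-d_0)\to 0 .$$ Then the Hilbert coefficients of $N$ are $$e_i(N)=\beta_0\,\frac{\prod_{j=1}^s d_j}{(s+i)!}\sum_{1\le j_1\le j_2\le\cdots\le j_i\le s}\ \prod_{k=1}^i\bigl(d_{j_k}-(j_k+k-1)\bigr),\qquad i=0,\ldots,n-s.$$
   Context: $S$ carries the standard grading ($\deg x_j=1$). The codimension of $N$ is $s=n-\dim N$. For a finitely generated graded $S$-module $N$ of dimension $d$, put $H(N,i)=\sum_{j\le i}\dim_K N_j$. There is a polynomial $P_N(x)\in\mathbb{Q}[x]$ of degree $d$ with $H(N,i)=P_N(i)$ for all $i\gg 0$ (the Hilbert polynomial of $N$). It can be written uniquely as $$P_N(x)=\sum_{i=0}^{d}(-1)^i e_i(N)\binom{x+d-i}{d-i}$$ with integers $e_i(N)$, called the Hilbert coefficients of $N$. In the situation of the claim $d=n-s$. For $i=0$ the sum over $1\le j_1\le\cdots\le j_i\le s$ consists of one term, an empty product equal to $1$. *)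

theory Defs
  imports
    Complex_Main
    "HOL-Library.Poly_Mapping"
    "HOL-Library.Function_Algebras"
    "HOL-Library.Extended_Nat"
    "HOL-Library.Cardinality"
    "HOL-Computational_Algebra.Polynomial"
begin

text \<open>The polynomial ring over a field \<open>'k\<close> in the variables indexed by the finite type \<open>'x\<close>, so
  that the number of variables is \<open>n = CARD('x)\<close>. A polynomial is a finitely supported map from
  exponent vectors to coefficients, with the convolution product of the library.\<close>

type_synonym ('x, 'k) mpoly = "('x \<Rightarrow>\<^sub>0 nat) \<Rightarrow>\<^sub>0 'k"

definition const_poly :: "'k::zero \<Rightarrow> ('x, 'k) mpoly" where
  "const_poly c = Poly_Mapping.single 0 c"

definition mon_degree :: "('x::finite \<Rightarrow>\<^sub>0 nat) \<Rightarrow> nat" where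
  "mon_degree m = (\<Sum>x\<in>UNIV. Poly_Mapping.lookup m x)"

text \<open>The graded pieces are indexed by all integers; those of negative index are zero.\<close>

definition homog_part :: "int \<Rightarrow> ('x::finite, 'k::zero) mpoly set" where
  "homog_part j = {p. \<forall>m\<in>Poly_Mapping.keys p. int (mon_degree m) = j}"

text \<open>The graded maximal ideal \<open>(x\<^sub>1, \<dots>, x\<^sub>n)\<close>: polynomials without constant term.\<close>

definition irrelevant_ideal :: "('x, 'k::zero) mpoly set" where
  "irrelevant_ideal = {p. Poly_Mapping.lookup p 0 = 0}"


subsection \<open>Modules over the polynomial ring\<close>

text \<open>A module is a type \<open>'v\<close> of class \<open>ab_group_add\<close> with a scalar multiplication satisfying the
  library locale \<open>module\<close>; quotients by submodules are expressed by membership in the submodule.\<close>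

definition finitely_generated ::
  "(('x, 'k::field) mpoly \<Rightarrow> 'v::ab_group_add \<Rightarrow> 'v) \<Rightarrow> bool" where
  "finitely_generated scale \<longleftrightarrow> (\<exists>B. finite B \<and> module.span scale B = UNIV)"

definition graded_module ::
  "(('x::finite, 'k::field) mpoly \<Rightarrow> 'v::ab_group_add \<Rightarrow> 'v) \<Rightarrow> (int \<Rightarrow> 'v set) \<Rightarrow> bool" where
  "graded_module scale N \<longleftrightarrow>
     module scale \<and>
     (\<forall>j. 0 \<in> N j \<and> (\<forall>u\<in>N j. \<forall>v\<in>N j. u - v \<in> N j)) \<and>
     (\<forall>v. \<exists>!c. (\<forall>j. c j \<in> N j) \<and> finite {j. c j \<noteq> 0} \<and> v = (\<Sum>j | c j \<noteq> 0. c j)) \<and>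
     (\<forall>i j. \<forall>p\<in>homog_part i. \<forall>v\<in>N j. scale p v \<in> N (i + j))"

definition annihilator ::
  "(('x, 'k::field) mpoly \<Rightarrow> 'v::ab_group_add \<Rightarrow> 'v) \<Rightarrow> ('x, 'k) mpoly set" where
  "annihilator scale = {p. \<forall>v. scale p v = 0}"

text \<open>Ideals of a commutative ring are its submodules over itself.\<close>

definition prime_ideal :: "'a::comm_ring_1 set \<Rightarrow> bool" where
  "prime_ideal P \<longleftrightarrow> module.subspace (*) P \<and> P \<noteq> UNIV \<and>
     (\<forall>a b. a * b \<in> P \<longrightarrow> a \<in> P \<or> b \<in> P)"

text \<open>The Krull dimension of the module \<open>N\<close>, that is, of the ring \<open>S / Ann N\<close>, as the supremum of
  the lengths of chains of primes containing \<open>Ann N\<close>. (For the zero module, not of interest here,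
  the supremum of the empty set is \<open>0\<close>.)\<close>

definition krull_dim ::
  "(('x, 'k::field) mpoly \<Rightarrow> 'v::ab_group_add \<Rightarrow> 'v) \<Rightarrow> enat" where
  "krull_dim scale = Sup {enat l | l. \<exists>P :: nat \<Rightarrow> ('x, 'k) mpoly set.
     (\<forall>i\<le>l. prime_ideal (P i) \<and> annihilator scale \<subseteq> P i) \<and> (\<forall>i<l. P i \<subset> P (Suc i))}"

definition mult_submodule ::
  "(('x, 'k::field) mpoly \<Rightarrow> 'v::ab_group_add \<Rightarrow> 'v) \<Rightarrow> ('x, 'k) mpoly set \<Rightarrow> 'v set" where
  "mult_submodule scale Y = module.span scale {scale y v | y v. y \<in> Y}"

text \<open>\<open>y\<^sub>1, \<dots>, y\<^sub>r\<close> is \<open>N\<close>-regular if each \<open>y\<^sub>k\<close> is a nonzerodivisor on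
  \<open>N / (y\<^sub>1, \<dots>, y\<^bsub>k-1\<^esub>) N\<close> and \<open>N \<noteq> (y\<^sub>1, \<dots>, y\<^sub>r) N\<close>.\<close>

definition regular_sequence ::
  "(('x, 'k::field) mpoly \<Rightarrow> 'v::ab_group_add \<Rightarrow> 'v) \<Rightarrow> ('x, 'k) mpoly list \<Rightarrow> bool" where
  "regular_sequence scale ys \<longleftrightarrow>
     (\<forall>k<length ys. \<forall>v. scale (ys ! k) v \<in> mult_submodule scale (set (take k ys))
         \<longrightarrow> v \<in> mult_submodule scale (set (take k ys))) \<and>
     mult_submodule scale (set ys) \<noteq> UNIV"

definition depth ::
  "(('x, 'k::field) mpoly \<Rightarrow> 'v::ab_group_add \<Rightarrow> 'v) \<Rightarrow> enat" where
  "depth scale = Sup {enat (length ys) | ys. set ys \<subseteq> irrelevant_ideal \<and> regular_sequence scale ys}"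

definition cohen_macaulay ::
  "(('x, 'k::field) mpoly \<Rightarrow> 'v::ab_group_add \<Rightarrow> 'v) \<Rightarrow> bool" where
  "cohen_macaulay scale \<longleftrightarrow> depth scale = krull_dim scale"


subsection \<open>Pure resolutions\<close>

text \<open>\<open>S\<^sup>b\<close> is realised as the functions on the natural numbers vanishing outside \<open>{..<b}\<close>, and
  \<open>free_part b a j\<close> is the degree \<open>j\<close> piece of \<open>S\<^sup>b(-a)\<close>, i.e. \<open>(S\<^bsub>j-a\<^esub>)\<^sup>b\<close>.\<close>

definition free_module :: "nat \<Rightarrow> (nat \<Rightarrow> ('x, 'k::field) mpoly) set" where
  "free_module b = {f. \<forall>k\<ge>b. f k = 0}"

definition free_scale ::
  "('x, 'k::field) mpoly \<Rightarrow> (nat \<Rightarrow> ('x, 'k) mpoly) \<Rightarrow> nat \<Rightarrow> ('x, 'k) mpoly" where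
  "free_scale p f = (\<lambda>k. p * f k)"

definition free_part :: "nat \<Rightarrow> int \<Rightarrow> int \<Rightarrow> (nat \<Rightarrow> ('x::finite, 'k::field) mpoly) set" where
  "free_part b a j = {f \<in> free_module b. \<forall>k<b. f k \<in> homog_part (j - a)}"

text \<open>Homogeneous module homomorphisms of degree \<open>0\<close> from \<open>S\<^sup>b(-a)\<close> to a graded module with
  scalar multiplication \<open>scale\<close> and graded pieces \<open>N\<close>.\<close>

definition graded_hom ::
  "nat \<Rightarrow> int \<Rightarrow> (('x::finite, 'k::field) mpoly \<Rightarrow> 'w::ab_group_add \<Rightarrow> 'w) \<Rightarrow> (int \<Rightarrow> 'w set)
   \<Rightarrow> ((nat \<Rightarrow> ('x, 'k) mpoly) \<Rightarrow> 'w) \<Rightarrow> bool" where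
  "graded_hom b a scale N \<phi> \<longleftrightarrow>
     (\<forall>f\<in>free_module b. \<forall>g\<in>free_module b. \<phi> (f + g) = \<phi> f + \<phi> g) \<and>
     (\<forall>p. \<forall>f\<in>free_module b. \<phi> (free_scale p f) = scale p (\<phi> f)) \<and>
     (\<forall>j. \<phi> ` free_part b a j \<subseteq> N j)"

text \<open>The minimal graded free resolution of \<open>N\<close> is pure of type \<open>(d 0, \<dots>, d s)\<close> with Betti numbers
  \<open>\<beta> 0, \<dots>, \<beta> s\<close>. The map \<open>\<phi> i\<close> goes from the \<open>i\<close>-th free module to the \<open>(i-1)\<close>-st for
  \<open>1 \<le> i \<le> s\<close>, and \<open>\<epsilon>\<close> is the augmentation onto \<open>N\<close>. Each free module in the resolution is
  nonzero, since otherwise \<open>d i\<close> would be meaningless. Minimality says that the image of each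
  \<open>\<phi> (i+1)\<close> lies in \<open>\<mm> F\<^sub>i\<close>, i.e. has all components in the graded maximal ideal.\<close>

definition pure_minimal_resolution ::
  "(('x::finite, 'k::field) mpoly \<Rightarrow> 'v::ab_group_add \<Rightarrow> 'v) \<Rightarrow> (int \<Rightarrow> 'v set)
   \<Rightarrow> nat \<Rightarrow> (nat \<Rightarrow> nat) \<Rightarrow> (nat \<Rightarrow> int) \<Rightarrow> bool" where
  "pure_minimal_resolution scale N s \<beta> d \<longleftrightarrow>
     (\<forall>i\<le>s. \<beta> i > 0) \<and>
     (\<exists>(\<epsilon> :: (nat \<Rightarrow> ('x, 'k) mpoly) \<Rightarrow> 'v)
       (\<phi> :: nat \<Rightarrow> (nat \<Rightarrow> ('x, 'k) mpoly) \<Rightarrow> nat \<Rightarrow> ('x, 'k) mpoly).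
        graded_hom (\<beta> 0) (d 0) scale N \<epsilon> \<and>
        (\<forall>i<s. graded_hom (\<beta> (Suc i)) (d (Suc i)) free_scale (free_part (\<beta> i) (d i)) (\<phi> (Suc i))) \<and>
        \<epsilon> ` free_module (\<beta> 0) = UNIV \<and>
        (\<forall>i\<le>s. {f \<in> free_module (\<beta> i). if i = 0 then \<epsilon> f = 0 else \<phi> i f = 0} =
                (if i < s then \<phi> (Suc i) ` free_module (\<beta> (Suc i)) else {0})) \<and>
        (\<forall>i<s. \<forall>f\<in>free_module (\<beta> (Suc i)). \<forall>k. \<phi> (Suc i) f k \<in> irrelevant_ideal))"


subsection \<open>Hilbert coefficients\<close>

text \<open>The sum is restricted to the nonzero graded pieces because a sum over the infinite set
  \<open>{..i}\<close> would be \<open>0\<close> by convention; for finitely generated modules the index set is finite.\<close>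

definition hilbert_sum ::
  "(('x, 'k::field) mpoly \<Rightarrow> 'v::ab_group_add \<Rightarrow> 'v) \<Rightarrow> (int \<Rightarrow> 'v set) \<Rightarrow> int \<Rightarrow> nat" where
  "hilbert_sum scale N i =
     (\<Sum>j | j \<le> i \<and> N j \<noteq> {0}. vector_space.dim (\<lambda>c. scale (const_poly c)) (N j))"

definition hilbert_poly ::
  "(('x, 'k::field) mpoly \<Rightarrow> 'v::ab_group_add \<Rightarrow> 'v) \<Rightarrow> (int \<Rightarrow> 'v set) \<Rightarrow> rat poly" where
  "hilbert_poly scale N =
     (THE P. \<forall>\<^sub>F i in at_top. of_nat (hilbert_sum scale N i) = poly P (of_int i))"

text \<open>The identity of polynomials is stated as an identity of functions on the rationals. Indices
  beyond \<open>dim N\<close>, for which there is no coefficient, get the value \<open>0\<close>.\<close>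

definition hilbert_coeff ::
  "(('x, 'k::field) mpoly \<Rightarrow> 'v::ab_group_add \<Rightarrow> 'v) \<Rightarrow> (int \<Rightarrow> 'v set) \<Rightarrow> nat \<Rightarrow> int" where
  "hilbert_coeff scale N =
     (let D = the_enat (krull_dim scale) in
      THE e. (\<forall>i>D. e i = 0) \<and>
        (\<forall>x::rat. poly (hilbert_poly scale N) x =
           (\<Sum>i\<le>D. (-1) ^ i * of_int (e i) * ((x + of_nat (D - i)) gchoose (D - i)))))"

end

theory Submission
  imports Defs "HOL-Computational_Algebra.Formal_Power_Series" "HOL-Library.FuncSet"
begin

text \<open>
  Write \<open>n\<close> for the number of variables and \<open>D = n - s\<close> for the dimension of \<open>N\<close>. Counting dimensions
  degree by degree along the resolution gives \<open>dim N\<^sub>j = \<Sum>\<^sub>k (-1)\<^sup>k \<beta>\<^sub>k dim S\<^bsub>j - d k\<^esub>\<close>, so the Hilbert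
  polynomial is \<open>P(x) = \<Sum>\<^sub>k (-1)\<^sup>k \<beta>\<^sub>k binom(x - d\<^sub>k + n, n)\<close>. Vandermonde's identity rewrites it
  in the basis used for the Hilbert coefficients: \<open>P(x) = \<Sum>\<^sub>m (-1)\<^sup>m a\<^sub>m binom(x + n - m, n - m)\<close> with
  \<open>a\<^sub>m = \<Sum>\<^sub>k (-1)\<^sup>k \<beta>\<^sub>k binom(d\<^sub>k, m)\<close>.

  The degree of \<open>P\<close> is at most \<open>D\<close>; hence \<open>a\<^sub>m = 0\<close> for \<open>m < s\<close>, and comparing coefficients yields
  \<open>e\<^sub>i = (-1)\<^sup>s a\<^bsub>s + i\<^esub>\<close>. The linear functional \<open>f \<mapsto> \<Sum>\<^sub>k (-1)\<^sup>k \<beta>\<^sub>k f(d\<^sub>k)\<close> thus kills all polynomials of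
  degree below \<open>s\<close> (these are the Herzog-Kuehl equations), and so it is a multiple of the divided difference
  at the nodes \<open>0, d\<^sub>1, \<dots>, d\<^sub>s\<close>. Applying it to a falling factorial, expanded in Newton's basis
  for these nodes, produces the sum in the claim; this is \<open>falling_factorial_moment\<close>.

  The bound on the degree of \<open>P\<close> says that the growth of the Hilbert function is at most the Krull
  dimension, that is, that fast growth forces a long chain of primes above the annihilator
  (\<open>hilbert_sum_growth\<close>). Call a set \<open>A\<close> of variables independent modulo a homogeneous ideal \<open>I\<close> if
  \<open>K[A] \<inter> I = 0\<close>. If no \<open>d\<close> variables are independent modulo \<open>I\<close>, then leading monomials of the resulting
  relations allow every form to be reduced modulo \<open>I\<close> to monomials with fewer than \<open>d\<close> large
  exponents (\<open>homogeneous_reduction\<close>), and there are only \<open>O(j\<^bsup>d - 1\<^esup>)\<close> such monomials of degree at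
  most \<open>j\<close>. Fast growth therefore provides a large independent set. Conversely, \<open>d\<close> independent variables
  produce a chain of \<open>d + 1\<close> primes (\<open>prime_chain_of_independent\<close>): enlarge \<open>I\<close> by
  Zorn's lemma to a homogeneous prime \<open>Q\<close> that still avoids \<open>K[A]\<close>, add a variable outside \<open>Q\<close>, and
  use the reduction once more to see that \<open>d - 1\<close> suitable variables stay independent.
\<close>

section \<open>Moments of falling factorials\<close>

text \<open>The factorial complete symmetric function of degree \<open>i\<close> in \<open>d\<^sub>1, \<dots>, d\<^sub>s\<close> with shift sequence
  \<open>1, 2, 3, \<dots>\<close>; for vanishing shifts it would be the complete symmetric polynomial.\<close>

definition shifted_sum :: "(nat \<Rightarrow> int) \<Rightarrow> nat \<Rightarrow> nat \<Rightarrow> rat" where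
  "shifted_sum d i s = (\<Sum>js | length js = i \<and> sorted js \<and> set js \<subseteq> {1..s}.
     \<Prod>k=1..i. of_int (d (js ! (k - 1)) - (int (js ! (k - 1)) + int k - 1)))"

lemma shifted_sum_0 [simp]: "shifted_sum d 0 s = 1"
proof -
  have "{js::nat list. length js = 0 \<and> sorted js \<and> set js \<subseteq> {1..s}} = {[]}" by auto
  then show ?thesis by (simp add: shifted_sum_def)
qed

lemma shifted_sum_Suc_0 [simp]: "shifted_sum d (Suc i) 0 = 0"
proof -
  have "{js::nat list. length js = Suc i \<and> sorted js \<and> set js \<subseteq> {1..0}} = {}" by auto
  then show ?thesis by (simp only: shifted_sum_def sum.empty)
qed

lemma finite_sorted_lists: "finite {js::nat list. length js = i \<and> sorted js \<and> set js \<subseteq> {1..s}}"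
  by (rule finite_subset[OF _ finite_lists_length_eq[of "{1..s}" i]]) auto

text \<open>Split the index lists according to whether the last, hence largest, entry is \<open>s + 1\<close>. Such an
  entry sits at position \<open>i + 1\<close> and contributes the factor \<open>d\<^bsub>s+1\<^esub> - (s + i + 1)\<close>.\<close>

lemma shifted_sum_rec:
  "shifted_sum d (Suc i) (Suc s) =
     shifted_sum d (Suc i) s + (of_int (d (Suc s)) - of_nat (s + i + 1)) * shifted_sum d i (Suc s)"
proof -
  define L where "L i s = {js::nat list. length js = i \<and> sorted js \<and> set js \<subseteq> {1..s}}" for i s
  define w where "w i js = (\<Prod>k=1..i. of_int (d (js ! (k - 1)) - (int (js ! (k - 1)) + int k - 1)) :: rat)"
    for i and js :: "nat list"
  have fin: "finite (L i s)" for i s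
    unfolding L_def by (rule finite_sorted_lists)
  have split: "L (Suc i) (Suc s) = L (Suc i) s \<union> (\<lambda>js. js @ [Suc s]) ` L i (Suc s)"
  proof (intro equalityI subsetI)
    fix js assume js: "js \<in> L (Suc i) (Suc s)"
    then have ne: "js \<noteq> []" by (auto simp: L_def)
    then obtain ys y where ysy: "js = ys @ [y]" by (metis append_butlast_last_id)
    have ub: "z \<le> y" if "z \<in> set js" for z
      using js ysy that by (auto simp: L_def sorted_append)
    show "js \<in> L (Suc i) s \<union> (\<lambda>js. js @ [Suc s]) ` L i (Suc s)"
    proof (cases "y = Suc s")
      case True
      have "ys \<in> L i (Suc s)" using js ysy by (auto simp: L_def sorted_append)
      then show ?thesis using ysy True by auto
    next
      case False
      then have "y \<le> s" using js ysy by (auto simp: L_def)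
      then have "z \<in> {1..s}" if "z \<in> set js" for z
        using ub[OF that] js that by (auto simp: L_def)
      then show ?thesis using js by (auto simp: L_def)
    qed
  next
    fix js assume "js \<in> L (Suc i) s \<union> (\<lambda>js. js @ [Suc s]) ` L i (Suc s)"
    then show "js \<in> L (Suc i) (Suc s)"
      by (fastforce simp: L_def sorted_append)
  qed
  have disj: "L (Suc i) s \<inter> (\<lambda>js. js @ [Suc s]) ` L i (Suc s) = {}"
    by (auto simp: L_def)
  have w_snoc: "w (Suc i) (js @ [Suc s]) = w i js * (of_int (d (Suc s)) - of_nat (s + i + 1))"
    if "js \<in> L i (Suc s)" for js
  proof -
    have len: "length js = i" using that by (simp add: L_def)
    have "w (Suc i) (js @ [Suc s]) =
        (\<Prod>k=1..i. of_int (d ((js @ [Suc s]) ! (k - 1)) - (int ((js @ [Suc s]) ! (k - 1)) + int k - 1)))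
        * of_int (d (Suc s) - (int (Suc s) + int (Suc i) - 1))"
      using len by (simp add: w_def nth_append)
    also have "(\<Prod>k=1..i. of_int (d ((js @ [Suc s]) ! (k - 1)) - (int ((js @ [Suc s]) ! (k - 1)) + int k - 1)))
        = w i js"
      unfolding w_def by (rule prod.cong) (use len in \<open>auto simp: nth_append\<close>)
    finally show ?thesis by (simp add: algebra_simps)
  qed
  have "sum (w (Suc i)) (L (Suc i) (Suc s)) = sum (w (Suc i)) (L (Suc i) s)
      + sum (w (Suc i)) ((\<lambda>js. js @ [Suc s]) ` L i (Suc s))"
    unfolding split by (rule sum.union_disjoint) (use fin disj in auto)
  also have "sum (w (Suc i)) ((\<lambda>js. js @ [Suc s]) ` L i (Suc s))
      = (\<Sum>js\<in>L i (Suc s). w i js * (of_int (d (Suc s)) - of_nat (s + i + 1)))"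
    by (subst sum.reindex) (auto simp: inj_on_def w_snoc)
  also have "\<dots> = (of_int (d (Suc s)) - of_nat (s + i + 1)) * sum (w i) (L i (Suc s))"
    by (simp add: sum_distrib_right mult.commute)
  finally show ?thesis by (simp add: shifted_sum_def w_def L_def)
qed

text \<open>Multiplying Newton's basis polynomial \<open>W\<^sub>r = (x - d\<^sub>1) \<cdots> (x - d\<^sub>r)\<close> by \<open>x - (M + 1)\<close> gives
  \<open>W\<^bsub>r+1\<^esub> + (d\<^bsub>r+1\<^esub> - (M + 1)) W\<^sub>r\<close>, so the coefficients obey the recursion above.\<close>

lemma newton_expansion:
  fixes x :: rat
  shows "(\<Prod>l=1..M. x - of_nat l) =
    (\<Sum>r\<le>M. shifted_sum d (M - r) (Suc r) * (\<Prod>j=1..r. x - of_int (d j)))"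
proof (induction M)
  case 0
  show ?case by simp
next
  case (Suc M)
  define W where "W r = (\<Prod>j=1..r. x - of_int (d j))" for r
  have W_Suc: "W (Suc r) = W r * (x - of_int (d (Suc r)))" for r by (simp add: W_def)
  have "(\<Prod>l=1..Suc M. x - of_nat l) = (\<Sum>r\<le>M. shifted_sum d (M - r) (Suc r) * W r) * (x - of_nat (Suc M))"
    unfolding W_def Suc.IH[symmetric] by simp
  also have "\<dots> = (\<Sum>r\<le>M. shifted_sum d (M - r) (Suc r) * W (Suc r))
      + (\<Sum>r\<le>M. shifted_sum d (M - r) (Suc r) * (of_int (d (Suc r)) - of_nat (Suc M)) * W r)"
    unfolding sum_distrib_right sum.distrib[symmetric]
    by (rule sum.cong) (simp_all add: W_Suc algebra_simps)
  also have "(\<Sum>r\<le>M. shifted_sum d (M - r) (Suc r) * W (Suc r)) = 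
     (\<Sum>r\<le>Suc M. shifted_sum d (Suc M - r) r * W r)"
    by (simp add: sum.atMost_Suc_shift del: sum.atMost_Suc)
  also have "(\<Sum>r\<le>Suc M. shifted_sum d (Suc M - r) r * W r) =
      (\<Sum>r\<le>M. shifted_sum d (Suc M - r) r * W r) + W (Suc M)" by simp
  also have "(\<Sum>r\<le>M. shifted_sum d (Suc M - r) r * W r) + W (Suc M)
      + (\<Sum>r\<le>M. shifted_sum d (M - r) (Suc r) * (of_int (d (Suc r)) - of_nat (Suc M)) * W r)
    = (\<Sum>r\<le>M. (shifted_sum d (Suc M - r) r
         + (of_int (d (Suc r)) - of_nat (Suc M)) * shifted_sum d (M - r) (Suc r)) * W r) + W (Suc M)"
    by (simp only: distrib_right sum.distrib) (simp add: algebra_simps)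
  also have "(\<Sum>r\<le>M. (shifted_sum d (Suc M - r) r
         + (of_int (d (Suc r)) - of_nat (Suc M)) * shifted_sum d (M - r) (Suc r)) * W r)
      = (\<Sum>r\<le>M. shifted_sum d (Suc M - r) (Suc r) * W r)"
  proof (rule sum.cong)
    fix r assume "r \<in> {..M}"
    then show "(shifted_sum d (Suc M - r) r
         + (of_int (d (Suc r)) - of_nat (Suc M)) * shifted_sum d (M - r) (Suc r)) * W r
       = shifted_sum d (Suc M - r) (Suc r) * W r"
      using shifted_sum_rec[of d "M - r" r] by (simp add: Suc_diff_le)
  qed simp
  finally show ?case by (simp add: W_def)
qed

text \<open>A functional on functions of \<open>d\<^sub>k\<close> that kills the binomials of degree below \<open>s\<close> kills every product of fewer than
  \<open>s\<close> linear factors. The extra binomial makes the induction on the number of factors go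
  through, since \<open>(y - c) binom(y, m)\<close> is a combination of \<open>binom(y, m + 1)\<close> and \<open>binom(y, m)\<close>.\<close>

lemma moments_vanish_products:
  fixes w :: "nat \<Rightarrow> rat" and d :: "nat \<Rightarrow> rat"
  assumes "\<And>m. m < s \<Longrightarrow> (\<Sum>k\<le>s. w k * (d k gchoose m)) = 0"
  shows "r + m < s \<Longrightarrow> (\<Sum>k\<le>s. w k * ((\<Prod>j=1..r. d k - c j) * (d k gchoose m))) = 0"
proof (induction r arbitrary: m)
  case 0
  then show ?case using assms by simp
next
  case (Suc r)
  have step: "(y - c (Suc r)) * (y gchoose m)
      = of_nat (Suc m) * (y gchoose Suc m) + (of_nat m - c (Suc r)) * (y gchoose m)" for y :: rat
    using gbinomial_mult_1[of y m] by (simp add: algebra_simps)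
  have "(\<Prod>j=1..Suc r. d k - c j) * (d k gchoose m)
      = of_nat (Suc m) * ((\<Prod>j=1..r. d k - c j) * (d k gchoose Suc m))
        + (of_nat m - c (Suc r)) * ((\<Prod>j=1..r. d k - c j) * (d k gchoose m))" for k
  proof -
    have "(\<Prod>j=1..Suc r. d k - c j) * (d k gchoose m)
        = (\<Prod>j=1..r. d k - c j) * ((d k - c (Suc r)) * (d k gchoose m))"
      by simp
    then show ?thesis unfolding step by (simp only: ring_distribs mult.assoc mult.left_commute)
  qed
  then have "(\<Sum>k\<le>s. w k * ((\<Prod>j=1..Suc r. d k - c j) * (d k gchoose m)))
    = of_nat (Suc m) * (\<Sum>k\<le>s. w k * ((\<Prod>j=1..r. d k - c j) * (d k gchoose Suc m)))
     + (of_nat m - c (Suc r)) * (\<Sum>k\<le>s. w k * ((\<Prod>j=1..r. d k - c j) * (d k gchoose m)))"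
    by (simp add: sum_distrib_left algebra_simps flip: sum.distrib)
  then show ?case using Suc.IH[of "Suc m"] Suc.IH[of m] Suc.prems by simp
qed

text \<open>Expand \<open>(x - 1) \<cdots> (x - (s + i - 1))\<close> in Newton's basis \<open>W\<^sub>r\<close> and multiply by \<open>x\<close>. The functional with
  weights \<open>w\<^sub>k\<close> kills \<open>x W\<^sub>r\<close> for \<open>r < s - 1\<close> by degree, and for \<open>r \<ge> s\<close> because \<open>x W\<^sub>r\<close> vanishes at all
  nodes \<open>0, d\<^sub>1, \<dots>, d\<^sub>s\<close>. On \<open>x W\<^bsub>s-1\<^esub> = W\<^sub>s + d\<^sub>s W\<^bsub>s-1\<^esub>\<close> only the value of \<open>W\<^sub>s\<close> at \<open>d\<^sub>0 = 0\<close>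
  survives. So only the Newton coefficient at \<open>W\<^bsub>s-1\<^esub>\<close> remains.\<close>

lemma falling_factorial_moment:
  fixes w :: "nat \<Rightarrow> rat" and d :: "nat \<Rightarrow> int"
  assumes d0: "d 0 = 0"
    and van: "\<And>m. m < s \<Longrightarrow> (\<Sum>k\<le>s. w k * (of_int (d k) gchoose m)) = 0"
  shows "(\<Sum>k\<le>s. w k * (of_int (d k) gchoose (s + i))) =
    (-1) ^ s * w 0 * (\<Prod>j=1..s. of_int (d j)) / fact (s + i) * shifted_sum d i s"
proof (cases s)
  case 0
  then show ?thesis using d0 by (cases i) (simp_all)
next
  case (Suc t)
  define W where "W r x = (\<Prod>j=1..r. x - of_int (d j))" for r and x :: rat
  define M where "M = t + i"
  have fall: "(x gchoose (s + i)) = x * (\<Prod>l=1..M. x - of_nat l) / fact (s + i)" for x :: rat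
  proof -
    have "(\<Prod>l=0..<s + i. x - of_nat l) = x * (\<Prod>l=1..M. x - of_nat l)"
    proof -
      have "{0..<s+i} = insert 0 {1..M}" using Suc by (auto simp: M_def)
      then show ?thesis by simp
    qed
    then show ?thesis by (simp add: gbinomial_prod_rev)
  qed
  have L0: "(\<Sum>k\<le>s. w k * (of_int (d k) * W r (of_int (d k)))) = 0" if "r \<le> M" "r \<noteq> t" for r
  proof (cases "r < t")
    case True
    then have "r + 1 < s" using Suc by simp
    from moments_vanish_products[where d = "\<lambda>k. of_int (d k)" and s = s and w = w, OF van this, of "\<lambda>j. of_int (d j)"]
    show ?thesis by (simp add: W_def mult.commute)
  next
    case False
    then have "s \<le> r" using that Suc by simp
    have "of_int (d k) * W r (of_int (d k)) = 0" if "k \<le> s" for k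
    proof (cases "k = 0")
      case False
      then have "k \<in> {1..r}" using that \<open>s \<le> r\<close> by simp
      then have "W r (of_int (d k)) = 0" unfolding W_def by (intro prod_zero) auto
      then show ?thesis by simp
    qed (use d0 in simp)
    then show ?thesis by (intro sum.neutral ballI) (metis atMost_iff mult_zero_right)
  qed
  have Lt: "(\<Sum>k\<le>s. w k * (of_int (d k) * W t (of_int (d k)))) = (-1)^s * w 0 * (\<Prod>j=1..s. of_int (d j))"
  proof -
    have eq: "y * W t y = W s y + of_int (d s) * W t y" for y
      by (simp add: W_def Suc algebra_simps)
    have z: "(\<Sum>k\<le>s. w k * W t (of_int (d k))) = 0"
      using moments_vanish_products[where d = "\<lambda>k. of_int (d k)" and s = s and w = w and m = 0
          and r = t and c = "\<lambda>j. of_int (d j)", OF van] Suc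
      by (simp add: W_def)
    have "(\<Sum>k\<le>s. w k * (of_int (d k) * W t (of_int (d k))))
       = (\<Sum>k\<le>s. w k * W s (of_int (d k))) + of_int (d s) * (\<Sum>k\<le>s. w k * W t (of_int (d k)))"
      by (simp only: eq) (simp add: algebra_simps sum.distrib sum_distrib_left)
    also have "\<dots> = (\<Sum>k\<le>s. w k * W s (of_int (d k)))" using z by simp
    also have "\<dots> = (\<Sum>k\<in>{0}. w k * W s (of_int (d k)))"
    proof (rule sum.mono_neutral_right)
      show "\<forall>k\<in>{..s} - {0}. w k * W s (of_int (d k)) = 0"
      proof
        fix k assume "k \<in> {..s} - {0}"
        then have "W s (of_int (d k)) = 0" unfolding W_def by (intro prod_zero) auto
        then show "w k * W s (of_int (d k)) = 0" by simp
      qed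
    qed auto
    also have "\<dots> = (-1)^s * w 0 * (\<Prod>j=1..s. of_int (d j))"
      by (simp add: d0 W_def prod_uminus)
    finally show ?thesis .
  qed
  have "(\<Sum>k\<le>s. w k * (of_int (d k) * (\<Prod>l=1..M. of_int (d k) - of_nat l)))
     = (\<Sum>k\<le>s. \<Sum>r\<le>M. shifted_sum d (M - r) (Suc r) * (w k * (of_int (d k) * W r (of_int (d k)))))"
    unfolding newton_expansion[of _ M d] W_def[symmetric]
    by (simp add: sum_distrib_left algebra_simps)
  also have "\<dots> = (\<Sum>r\<le>M. shifted_sum d (M - r) (Suc r) * (\<Sum>k\<le>s. w k * (of_int (d k) * W r (of_int (d k)))))"
    by (subst sum.swap) (simp add: sum_distrib_left)
  also have "\<dots> = (\<Sum>r\<in>{t}. shifted_sum d (M - r) (Suc r) * (\<Sum>k\<le>s. w k * (of_int (d k) * W r (of_int (d k)))))"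
    by (rule sum.mono_neutral_right) (auto simp: M_def L0)
  also have "\<dots> = shifted_sum d i s * ((-1)^s * w 0 * (\<Prod>j=1..s. of_int (d j)))"
    using Lt by (simp add: M_def Suc)
  finally have key: "(\<Sum>k\<le>s. w k * (of_int (d k) * (\<Prod>l=1..M. of_int (d k) - of_nat l)))
     = shifted_sum d i s * ((-1)^s * w 0 * (\<Prod>j=1..s. of_int (d j)))" .
  have "(\<Sum>k\<le>s. w k * (of_int (d k) gchoose (s + i))) =
     (\<Sum>k\<le>s. w k * (of_int (d k) * (\<Prod>l=1..M. of_int (d k) - of_nat l))) / fact (s + i)"
    unfolding fall by (simp add: sum_divide_distrib)
  then show ?thesis unfolding key by simp
qed

section \<open>Polynomials in the binomial basis\<close>

text \<open>The polynomial form of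
  \<open>t\<^sup>d / (1 - t)\<^bsup>n+1\<^esup> = (1 - (1 - t))\<^sup>d / (1 - t)\<^bsup>n+1\<^esup>\<close>, obtained from Vandermonde's identity after negating upper indices.\<close>

lemma gbinomial_shift_expansion:
  fixes x d :: "'a::field_char_0"
  shows "(x + of_nat n - d gchoose n) =
    (\<Sum>m\<le>n. (-1) ^ m * (d gchoose m) * (x + of_nat (n - m) gchoose (n - m)))"
proof -
  have "(x + of_nat n - d gchoose n) = (-1)^n * ((d + (- x - 1)) gchoose n)"
    using gbinomial_negated_upper[of "x + of_nat n - d" n] by (simp add: algebra_simps)
  also have "((d + (- x - 1)) gchoose n) = (\<Sum>m\<le>n. (d gchoose m) * ((- x - 1) gchoose (n - m)))"
    using gbinomial_Vandermonde[of d "- x - 1" n, symmetric] unfolding atLeast0AtMost .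
  also have "(-1)^n * (\<Sum>m\<le>n. (d gchoose m) * ((- x - 1) gchoose (n - m)))
     = (\<Sum>m\<le>n. (-1) ^ m * (d gchoose m) * (x + of_nat (n - m) gchoose (n - m)))"
    unfolding sum_distrib_left
  proof (rule sum.cong)
    have reorder: "a * (b * (c * e)) = (a * c) * b * e" for a b c e :: 'a by (simp only: mult_ac)
    fix m assume "m \<in> {..n}"
    then have "(-1::'a)^n * (-1)^(n-m) = (-1)^m"
      by (metis (no_types, lifting) atMost_iff le_add_diff_inverse2 left_minus_one_mult_self mult.commute power_add)
    moreover have "((- x - 1) gchoose (n - m)) = (-1)^(n-m) * (x + of_nat (n - m) gchoose (n - m))"
      by (subst gbinomial_negated_upper) (simp add: algebra_simps)
    ultimately show "(-1)^n * ((d gchoose m) * ((- x - 1) gchoose (n - m))) =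
       (-1) ^ m * (d gchoose m) * (x + of_nat (n - m) gchoose (n - m))"
      using reorder[of "(-1)^n" "d gchoose m" "(-1)^(n-m)" "x + of_nat (n - m) gchoose (n - m)"]
      by metis
  qed simp
  finally show ?thesis .
qed

definition binom_poly :: "nat \<Rightarrow> rat poly" where
  "binom_poly r = smult (1 / fact r) (\<Prod>l=1..r. [:of_nat l, 1:])"

lemma poly_binom_poly [simp]: "poly (binom_poly r) x = (x + of_nat r gchoose r)"
proof -
  have "(x + of_nat r gchoose r) = pochhammer (x + 1) r / fact r"
    by (simp add: gbinomial_pochhammer')
  also have "pochhammer (x + 1) r = (\<Prod>l=1..r. of_nat l + x)"
    by (induction r) (auto simp: pochhammer_Suc algebra_simps)
  finally show ?thesis by (simp add: binom_poly_def poly_prod)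
qed

lemma degree_binom_poly: "degree (binom_poly r) = r"
proof -
  have "degree (\<Prod>l=1..r. [:of_nat l :: rat, 1:]) = (\<Sum>l=1..r. degree [:of_nat l :: rat, 1:])"
    by (rule degree_prod_eq_sum_degree) auto
  then show ?thesis by (simp add: binom_poly_def)
qed

lemma binom_poly_nonzero: "binom_poly r \<noteq> 0"
  by (simp add: binom_poly_def prod_zero_iff)

text \<open>The polynomials \<open>binom(x + r, r)\<close> have pairwise distinct degrees. The case \<open>D = 0\<close> is their linear
  independence; larger \<open>D\<close> says that a combination of degree below \<open>D\<close> involves only those with \<open>r < D\<close>.\<close>

lemma binom_poly_coefficients_vanish:
  assumes "\<And>k. D \<le> k \<Longrightarrow> coeff (\<Sum>r\<le>n. smult (c r) (binom_poly r)) k = 0"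
  shows "D \<le> r \<Longrightarrow> r \<le> n \<Longrightarrow> c r = 0"
  using assms
proof (induction n arbitrary: r)
  case 0
  have "coeff (binom_poly 0) 0 \<noteq> 0" by (simp add: binom_poly_def)
  then show ?case using 0 by (auto simp: mult_eq_0_iff)
next
  case (Suc n)
  show ?case
  proof (cases "D \<le> Suc n")
    case False
    then show ?thesis using Suc by simp
  next
    case True
    have "degree (\<Sum>r\<le>n. smult (c r) (binom_poly r)) \<le> n"
      by (rule degree_sum_le) (auto intro: order_trans[OF degree_smult_le] simp: degree_binom_poly)
    then have low: "coeff (\<Sum>r\<le>n. smult (c r) (binom_poly r)) (Suc n) = 0"
      by (intro coeff_eq_0) simp
    have "coeff (binom_poly (Suc n)) (Suc n) \<noteq> 0"
      using leading_coeff_0_iff[of "binom_poly (Suc n)"] binom_poly_nonzero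
      by (simp add: degree_binom_poly)
    then have z: "c (Suc n) = 0"
      using Suc.prems(3)[OF True] low by simp
    have "coeff (\<Sum>r\<le>n. smult (c r) (binom_poly r)) k = 0" if "D \<le> k" for k
      using Suc.prems(3)[OF that] z by simp
    then show ?thesis using Suc.IH[of r] Suc.prems(1,2) z by (cases "r = Suc n") auto
  qed
qed

text \<open>Subtracting the comparison polynomial of degree \<open>D\<close> from a polynomial of larger degree does not
  change the leading term, whose sign decides the sign of the values at large arguments. The
  lower bound excludes a negative, the upper bound a positive leading coefficient.\<close>

lemma degree_le_of_growth:
  fixes P :: "rat poly"
  assumes "\<And>i. i \<ge> i0 \<Longrightarrow> 0 \<le> poly P (of_nat i) \<and> poly P (of_nat i) \<le> C * (of_nat i + 1) ^ D"
  shows "degree P \<le> D"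
proof (rule ccontr)
  assume "\<not> degree P \<le> D"
  then have D: "D < degree P" by simp
  define T where "T = smult C ([:1, 1:] ^ D)"
  have degT: "degree T \<le> D"
    unfolding T_def by (rule order_trans[OF degree_smult_le]) (simp add: degree_linear_power)
  have not_neg: False if "\<And>i. i \<ge> i0 \<Longrightarrow> poly Q (of_nat i) \<le> 0" "lead_coeff Q > 0" for Q :: "rat poly"
  proof -
    define R where "R = map_poly (of_rat :: rat \<Rightarrow> real) Q"
    have polyR: "poly R (of_nat i) = of_rat (poly Q (of_nat i))" for i
      unfolding R_def by (induction Q) (auto simp: map_poly_pCons of_rat_add of_rat_mult)
    have "lead_coeff R = of_rat (lead_coeff Q)"
      unfolding R_def by (simp add: degree_map_poly coeff_map_poly)
    then have "lead_coeff R > 0" using that(2) by simp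
    from poly_pinfty_gt_lc[OF this] obtain m where m: "\<And>x. x \<ge> m \<Longrightarrow> poly R x \<ge> lead_coeff R" by blast
    obtain k :: nat where "real k \<ge> m" using real_arch_simple by blast
    then have "real (max k i0) \<ge> m" by simp
    from m[OF this] \<open>lead_coeff R > 0\<close> have "poly R (real (max k i0)) > 0" by simp
    then have "poly Q (of_nat (max k i0)) > 0" using polyR[of "max k i0"] by simp
    then show False using that(1)[of "max k i0"] by simp
  qed
  have "P \<noteq> 0" using D by auto
  then consider "lead_coeff P > 0" | "lead_coeff P < 0"
    using leading_coeff_0_iff[of P] by linarith
  then show False
  proof cases
    case 1
    have "coeff T (degree P) = 0" using degT D by (intro coeff_eq_0) simp
    moreover have "degree (P - T) = degree P"
      using degree_add_eq_left[of "- T" P] degT D by simp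
    ultimately have "lead_coeff (P - T) = lead_coeff P" by simp
    then show False using not_neg[of "P - T"] assms 1
      by (simp add: T_def poly_power add.commute)
  next
    case 2
    then show False using not_neg[of "- P"] assms by simp
  qed
qed

lemma rat_poly_eq_of_eventually:
  fixes P Q :: "rat poly"
  assumes "\<forall>\<^sub>F i in at_top. poly P (of_int i) = poly Q (of_int i)"
  shows "P = Q"
proof (rule ccontr)
  assume "P \<noteq> Q"
  then have "finite {x. poly (P - Q) x = 0}" by (intro poly_roots_finite) simp
  moreover obtain i0 where "\<And>i. i \<ge> i0 \<Longrightarrow> poly P (of_int i) = poly Q (of_int i)"
    using assms by (auto simp: eventually_at_top_linorder)
  then have "(of_int :: int \<Rightarrow> rat) ` {i0..} \<subseteq> {x. poly (P - Q) x = 0}" by auto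
  ultimately have "finite ((of_int :: int \<Rightarrow> rat) ` {i0..})" using finite_subset by blast
  then have "finite {i0..}" by (rule finite_imageD) (auto simp: inj_on_def)
  then show False using infinite_Ici by blast
qed

section \<open>Monomials and coefficients\<close>

lemma const_poly_0 [simp]: "const_poly 0 = 0"
  and const_poly_1 [simp]: "const_poly 1 = 1"
  by (simp_all add: const_poly_def)

lemma const_poly_add: "const_poly (a + b) = const_poly a + const_poly b"
  by (simp add: const_poly_def single_add)

lemma const_poly_mult: "const_poly (a * b) = const_poly a * const_poly b"
  by (simp add: const_poly_def mult_single)

lemma keys_const_poly: "Poly_Mapping.keys (const_poly c) \<subseteq> {0}"
  by (simp add: const_poly_def)

abbreviation xpow :: "('x \<Rightarrow>\<^sub>0 nat) \<Rightarrow> ('x, 'k::zero_neq_one) mpoly" where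
  "xpow m \<equiv> Poly_Mapping.single m 1"

lemma const_poly_times_xpow: "const_poly c * xpow m = (Poly_Mapping.single m c :: ('x, 'k::field) mpoly)"
  by (simp add: const_poly_def mult_single)

lemma mpoly_sum_singles: "p = (\<Sum>m\<in>Poly_Mapping.keys p. Poly_Mapping.single m (Poly_Mapping.lookup p m))"
proof (rule poly_mapping_eqI)
  fix k
  show "Poly_Mapping.lookup p k =
      Poly_Mapping.lookup (\<Sum>m\<in>Poly_Mapping.keys p. Poly_Mapping.single m (Poly_Mapping.lookup p m)) k"
    by (cases "k \<in> Poly_Mapping.keys p")
       (auto simp: lookup_sum lookup_single when_def in_keys_iff sum.delta)
qed

lemma lookup_times:
  fixes p q :: "('x, 'k::field) mpoly"
  shows "Poly_Mapping.lookup (p * q) k =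
    (\<Sum>(a, b)\<in>Poly_Mapping.keys p \<times> Poly_Mapping.keys q.
       Poly_Mapping.lookup p a * Poly_Mapping.lookup q b when k = a + b)"
proof -
  have "p * q = (\<Sum>a\<in>Poly_Mapping.keys p. \<Sum>b\<in>Poly_Mapping.keys q.
      Poly_Mapping.single (a + b) (Poly_Mapping.lookup p a * Poly_Mapping.lookup q b))"
    by (subst mpoly_sum_singles[of p], subst mpoly_sum_singles[of q])
       (simp add: sum_product mult_single)
  then show ?thesis
    by (simp add: lookup_sum lookup_single sum.cartesian_product case_prod_unfold when_def eq_commute)
qed

lemma lookup_const_poly_times [simp]:
  fixes p :: "('x, 'k::field) mpoly"
  shows "Poly_Mapping.lookup (const_poly c * p) m = c * Poly_Mapping.lookup p m"
  by (simp add: const_poly_def flip: mult_map_scale_conv_mult) (simp add: Poly_Mapping.map.rep_eq when_def)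

lemma mon_degree_0 [simp]: "mon_degree 0 = 0"
  and mon_degree_add: "mon_degree (a + b) = mon_degree a + mon_degree b"
  by (simp_all add: mon_degree_def lookup_add sum.distrib)

lemma mon_degree_single [simp]: "mon_degree (Poly_Mapping.single x k) = k"
  by (simp add: mon_degree_def lookup_single when_def)

lemma lookup_le_mon_degree: "Poly_Mapping.lookup m x \<le> mon_degree m"
  unfolding mon_degree_def by (rule member_le_sum) auto

section \<open>Homogeneous components\<close>

definition hcomp :: "int \<Rightarrow> ('x::finite, 'k::field) mpoly \<Rightarrow> ('x, 'k) mpoly" where
  "hcomp j p = Abs_poly_mapping (\<lambda>m. Poly_Mapping.lookup p m when int (mon_degree m) = j)"

lemma lookup_hcomp: "Poly_Mapping.lookup (hcomp j p) m = (Poly_Mapping.lookup p m when int (mon_degree m) = j)"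
proof -
  have "finite {m. (Poly_Mapping.lookup p m when int (mon_degree m) = j) \<noteq> 0}"
    by (rule finite_subset[OF _ finite_keys[of p]]) (auto simp: in_keys_iff)
  then show ?thesis by (simp add: hcomp_def)
qed

lemma keys_hcomp: "Poly_Mapping.keys (hcomp j p) = {m \<in> Poly_Mapping.keys p. int (mon_degree m) = j}"
  by (auto simp: in_keys_iff lookup_hcomp when_def split: if_splits)

lemma hcomp_homog [simp]: "hcomp j p \<in> homog_part j"
  by (auto simp: homog_part_def keys_hcomp)

lemma hcomp_0 [simp]: "hcomp j 0 = 0"
  by (rule poly_mapping_eqI) (simp add: lookup_hcomp)

lemma hcomp_add: "hcomp j (p + q) = hcomp j p + hcomp j q"
  by (rule poly_mapping_eqI) (simp add: lookup_hcomp lookup_add when_def)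

lemma hcomp_sum: "hcomp j (sum f A) = (\<Sum>a\<in>A. hcomp j (f a))"
  by (induction A rule: infinite_finite_induct) (simp_all add: hcomp_add)

lemma hcomp_of_homog: "p \<in> homog_part i \<Longrightarrow> hcomp j p = (if j = i then p else 0)"
  by (rule poly_mapping_eqI) (auto simp: lookup_hcomp homog_part_def when_def in_keys_iff)

definition degs :: "('x::finite, 'k::field) mpoly \<Rightarrow> int set" where
  "degs p = (\<lambda>m. int (mon_degree m)) ` Poly_Mapping.keys p"

lemma finite_degs [simp]: "finite (degs p)"
  by (simp add: degs_def)

lemma sum_hcomp:
  assumes "finite J" "degs p \<subseteq> J"
  shows "(\<Sum>j\<in>J. hcomp j p) = p"
proof (rule poly_mapping_eqI)
  fix m
  have "(\<Sum>j\<in>J. Poly_Mapping.lookup p m when int (mon_degree m) = j) = Poly_Mapping.lookup p m"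
    using assms by (cases "int (mon_degree m) \<in> J") (auto simp: when_def degs_def image_subset_iff in_keys_iff)
  then show "Poly_Mapping.lookup (\<Sum>j\<in>J. hcomp j p) m = Poly_Mapping.lookup p m"
    by (simp add: lookup_sum lookup_hcomp)
qed

lemma homog_0 [simp]: "0 \<in> homog_part j"
  by (simp add: homog_part_def)

lemma homog_add: "p \<in> homog_part j \<Longrightarrow> q \<in> homog_part j \<Longrightarrow> p + q \<in> homog_part j"
  for p q :: "('x::finite, 'k::field) mpoly"
  using Poly_Mapping.keys_add[of p q] by (auto simp: homog_part_def)

lemma homog_diff: "p \<in> homog_part j \<Longrightarrow> q \<in> homog_part j \<Longrightarrow> p - q \<in> homog_part j"
  for p q :: "('x::finite, 'k::field) mpoly"
  by (auto simp: homog_part_def in_keys_iff lookup_minus)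

lemma homog_mult: "p \<in> homog_part i \<Longrightarrow> q \<in> homog_part j \<Longrightarrow> p * q \<in> homog_part (i + j)"
  for p q :: "('x::finite, 'k::field) mpoly"
  using keys_mult[of p q] by (fastforce simp: homog_part_def mon_degree_add)

lemma homog_const_poly: "const_poly c \<in> homog_part 0"
  using keys_const_poly[of c] by (auto simp: homog_part_def)

lemma homog_scale: "q \<in> homog_part j \<Longrightarrow> const_poly c * q \<in> homog_part j"
  for q :: "('x::finite, 'k::field) mpoly"
  using homog_mult[OF homog_const_poly] by fastforce

lemma homog_single: "Poly_Mapping.single m c \<in> homog_part (int (mon_degree m))"
  by (simp add: homog_part_def)

lemma homog_negative: "j < 0 \<Longrightarrow> p \<in> homog_part j \<Longrightarrow> p = 0"
  by (auto simp: homog_part_def in_keys_iff intro!: poly_mapping_eqI)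

lemma hcomp_mult_homog:
  assumes "q \<in> homog_part i"
  shows "hcomp j (p * q) = hcomp (j - i) p * q"
proof -
  have "hcomp j (p * q) = hcomp j ((\<Sum>l\<in>degs p. hcomp l p) * q)"
    by (simp add: sum_hcomp)
  also have "\<dots> = (\<Sum>l\<in>degs p. hcomp j (hcomp l p * q))"
    by (simp add: sum_distrib_right hcomp_sum)
  also have "\<dots> = (\<Sum>l\<in>degs p. if l = j - i then hcomp l p * q else 0)"
    by (rule sum.cong) (auto simp: hcomp_of_homog[OF homog_mult[OF hcomp_homog assms]])
  also have "\<dots> = hcomp (j - i) p * q"
  proof (cases "j - i \<in> degs p")
    case False
    then have "Poly_Mapping.keys (hcomp (j - i) p) = {}" by (auto simp: keys_hcomp degs_def) (metis image_eqI)
    then have "hcomp (j - i) p = 0" by simp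
    then show ?thesis using False by simp
  qed simp
  finally show ?thesis .
qed

section \<open>A monomial order\<close>

definition var_index :: "'x::finite \<Rightarrow> nat" where
  "var_index = (SOME f. inj f)"

lemma inj_var_index: "inj (var_index :: 'x::finite \<Rightarrow> nat)"
proof -
  obtain f :: "'x \<Rightarrow> nat" where "inj f"
    using finite_imp_inj_to_nat_seg[of "UNIV :: 'x set"] by auto
  then show ?thesis unfolding var_index_def by (rule someI[where P = inj])
qed

text \<open>Exponent vectors indexed by natural numbers carry the lexicographic order of the library, which is
  compatible with addition. Numbering the variables transports it to an arbitrary finite index type.\<close>

definition order_key :: "('x::finite \<Rightarrow>\<^sub>0 nat) \<Rightarrow> (nat \<Rightarrow>\<^sub>0 nat)" where
  "order_key m = (\<Sum>x\<in>UNIV. Poly_Mapping.single (var_index x) (Poly_Mapping.lookup m x))"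

lemma order_key_add: "order_key (a + b) = order_key a + order_key b"
  by (simp add: order_key_def lookup_add single_add sum.distrib)

lemma order_key_inject: "order_key a = order_key b \<longleftrightarrow> a = b"
proof
  have key: "Poly_Mapping.lookup (order_key m) (var_index x) = Poly_Mapping.lookup m x" for m and x :: 'a
    by (simp add: order_key_def lookup_sum lookup_single when_def inj_eq[OF inj_var_index])
  assume "order_key a = order_key b"
  then show "a = b" by (intro poly_mapping_eqI) (metis key)
qed simp

definition lead :: "('x::finite, 'k::field) mpoly \<Rightarrow> ('x \<Rightarrow>\<^sub>0 nat)" where
  "lead p = (SOME m. m \<in> Poly_Mapping.keys p \<and> (\<forall>m'\<in>Poly_Mapping.keys p. order_key m' \<le> order_key m))"

lemma
  assumes "p \<noteq> 0"
  shows lead_in_keys: "lead p \<in> Poly_Mapping.keys p"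
    and le_lead: "m \<in> Poly_Mapping.keys p \<Longrightarrow> order_key m \<le> order_key (lead p)"
proof -
  have ne: "order_key ` Poly_Mapping.keys p \<noteq> {}" using assms by simp
  have "Max (order_key ` Poly_Mapping.keys p) \<in> order_key ` Poly_Mapping.keys p"
    by (rule Max_in) (use ne in auto)
  then obtain m where "m \<in> Poly_Mapping.keys p" "order_key m = Max (order_key ` Poly_Mapping.keys p)" by auto
  then have "\<exists>m. m \<in> Poly_Mapping.keys p \<and> (\<forall>m'\<in>Poly_Mapping.keys p. order_key m' \<le> order_key m)"
    by (intro exI[of _ m]) simp
  from someI_ex[OF this]
  show "lead p \<in> Poly_Mapping.keys p"
    and "m \<in> Poly_Mapping.keys p \<Longrightarrow> order_key m \<le> order_key (lead p)" for m
    unfolding lead_def[symmetric] by auto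
qed

text \<open>Only the pair of leading monomials contributes to the coefficient at their sum.\<close>

lemma lookup_lead_times:
  fixes p q :: "('x::finite, 'k::field) mpoly"
  assumes "p \<noteq> 0" "q \<noteq> 0"
  shows "Poly_Mapping.lookup (p * q) (lead p + lead q) =
    Poly_Mapping.lookup p (lead p) * Poly_Mapping.lookup q (lead q)"
proof -
  have *: "a = lead p \<and> b = lead q"
    if "a \<in> Poly_Mapping.keys p" "b \<in> Poly_Mapping.keys q" "lead p + lead q = a + b" for a b
  proof -
    have a: "order_key a \<le> order_key (lead p)" and b: "order_key b \<le> order_key (lead q)"
      using assms that le_lead by auto
    have eq: "order_key (lead p) + order_key (lead q) = order_key a + order_key b"
      using that(3) by (simp flip: order_key_add)
    have "order_key a = order_key (lead p)"
      using add_less_le_mono[of "order_key a" "order_key (lead p)" "order_key b" "order_key (lead q)"] a b eq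
      by (metis order_less_irrefl order_le_less)
    then have "a = lead p" by (simp add: order_key_inject)
    then show ?thesis using that(3) by simp
  qed
  have "Poly_Mapping.lookup (p * q) (lead p + lead q) = (\<Sum>(a, b)\<in>{(lead p, lead q)}.
       Poly_Mapping.lookup p a * Poly_Mapping.lookup q b when lead p + lead q = a + b)"
    unfolding lookup_times
    by (rule sum.mono_neutral_right) (use * in \<open>auto simp: assms lead_in_keys when_def split: if_splits\<close>)
  then show ?thesis by simp
qed

lemma mpoly_mult_nonzero:
  fixes p q :: "('x::finite, 'k::field) mpoly"
  assumes "p \<noteq> 0" "q \<noteq> 0"
  shows "p * q \<noteq> 0"
proof
  assume "p * q = 0"
  then have "Poly_Mapping.lookup p (lead p) * Poly_Mapping.lookup q (lead q) = 0"
    using lookup_lead_times[OF assms] by simp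
  then show False using lead_in_keys assms by (auto simp: in_keys_iff)
qed

section \<open>Homogeneous ideals and independent variables\<close>

definition homogeneous_ideal :: "('x::finite, 'k::field) mpoly set \<Rightarrow> bool" where
  "homogeneous_ideal I \<longleftrightarrow> 0 \<in> I \<and> (\<forall>p\<in>I. \<forall>q\<in>I. p + q \<in> I) \<and> (\<forall>p. \<forall>q\<in>I. p * q \<in> I) \<and>
     (\<forall>p\<in>I. \<forall>j. hcomp j p \<in> I)"

lemma homogeneous_idealD:
  assumes "homogeneous_ideal I"
  shows ideal_0: "0 \<in> I" and ideal_add: "p \<in> I \<Longrightarrow> q \<in> I \<Longrightarrow> p + q \<in> I"
    and ideal_mult: "q \<in> I \<Longrightarrow> p * q \<in> I" and ideal_hcomp: "p \<in> I \<Longrightarrow> hcomp j p \<in> I"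
  using assms by (auto simp: homogeneous_ideal_def)

lemma ideal_uminus: "homogeneous_ideal I \<Longrightarrow> p \<in> I \<Longrightarrow> - p \<in> I"
  using ideal_mult[of I p "- 1"] by simp

lemma ideal_diff: "homogeneous_ideal I \<Longrightarrow> p \<in> I \<Longrightarrow> q \<in> I \<Longrightarrow> p - q \<in> I"
  using ideal_add[of I p "- q"] ideal_uminus[of I q] by simp

lemma ideal_sum: "homogeneous_ideal I \<Longrightarrow> (\<And>a. a \<in> A \<Longrightarrow> f a \<in> I) \<Longrightarrow> sum f A \<in> I"
  by (induction A rule: infinite_finite_induct) (auto intro: ideal_0 ideal_add)

text \<open>The variables in \<open>A\<close> are algebraically independent modulo \<open>I\<close>, that is, \<open>K[A] \<inter> I = 0\<close>.\<close>

definition independent_mod ::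
  "'x set \<Rightarrow> ('x::finite, 'k::field) mpoly set \<Rightarrow> bool" where
  "independent_mod A I \<longleftrightarrow>
     (\<forall>p\<in>I. (\<forall>m\<in>Poly_Mapping.keys p. Poly_Mapping.keys m \<subseteq> A) \<longrightarrow> p = 0)"

lemma ideal_adjoin:
  assumes I: "homogeneous_ideal I" and f: "f \<in> homog_part i"
  shows "homogeneous_ideal {p + f * r | p r. p \<in> I}"
  unfolding homogeneous_ideal_def
proof (intro conjI ballI allI)
  show "0 \<in> {p + f * r | p r. p \<in> I}"
    using ideal_0[OF I] by (intro CollectI exI[of _ 0]) simp
next
  fix p q assume "p \<in> {p + f * r | p r. p \<in> I}" "q \<in> {p + f * r | p r. p \<in> I}"
  then obtain a r b t where "p = a + f * r" "q = b + f * t" "a \<in> I" "b \<in> I" by auto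
  then have "p + q = (a + b) + f * (r + t)" "a + b \<in> I"
    using ideal_add[OF I] by (simp_all add: algebra_simps)
  then show "p + q \<in> {p + f * r | p r. p \<in> I}" by blast
next
  fix p q assume "q \<in> {p + f * r | p r. p \<in> I}"
  then obtain b t where "q = b + f * t" "b \<in> I" by auto
  then have "p * q = p * b + f * (p * t)" "p * b \<in> I"
    using ideal_mult[OF I] by (simp_all add: algebra_simps)
  then show "p * q \<in> {p + f * r | p r. p \<in> I}" by blast
next
  fix p j assume "p \<in> {p + f * r | p r. p \<in> I}"
  then obtain a r where "p = a + f * r" "a \<in> I" by auto
  then have "hcomp j p = hcomp j a + f * hcomp (j - i) r" "hcomp j a \<in> I"
    using ideal_hcomp[OF I] hcomp_mult_homog[OF f, of j r] by (simp_all add: hcomp_add mult.commute)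
  then show "hcomp j p \<in> {p + f * r | p r. p \<in> I}" by blast
qed

section \<open>Homogeneous primes\<close>

text \<open>Induction on the total number of terms. The product of the top components of \<open>a\<close> and \<open>b\<close> is the top component of
  \<open>a b\<close> and so lies in \<open>Q\<close>; by assumption one of the factors does, and it can be subtracted.\<close>

lemma prime_from_homogeneous_elements:
  assumes Q: "homogeneous_ideal Q"
    and pr: "\<And>a b i j. a \<in> homog_part i \<Longrightarrow> b \<in> homog_part j \<Longrightarrow> a * b \<in> Q \<Longrightarrow> a \<in> Q \<or> b \<in> Q"
  shows "a * b \<in> Q \<Longrightarrow> a \<in> Q \<or> b \<in> Q"
proof (induction "card (Poly_Mapping.keys a) + card (Poly_Mapping.keys b)" arbitrary: a b rule: less_induct)
  case less
  show ?case
  proof (cases "a = 0 \<or> b = 0")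
    case True
    then show ?thesis using ideal_0[OF Q] by auto
  next
    case False
    define i where "i = Max (degs a)"
    define j where "j = Max (degs b)"
    have i: "i \<in> degs a" unfolding i_def using False by (intro Max_in) (auto simp: degs_def)
    have j: "j \<in> degs b" unfolding j_def using False by (intro Max_in) (auto simp: degs_def)
    define a' where "a' = a - hcomp i a"
    define b' where "b' = b - hcomp j b"
    have keys_a': "Poly_Mapping.keys a' = {m \<in> Poly_Mapping.keys a. int (mon_degree m) \<noteq> i}"
      by (auto simp: a'_def in_keys_iff lookup_minus lookup_hcomp when_def split: if_splits)
    have keys_b': "Poly_Mapping.keys b' = {m \<in> Poly_Mapping.keys b. int (mon_degree m) \<noteq> j}"
      by (auto simp: b'_def in_keys_iff lookup_minus lookup_hcomp when_def split: if_splits)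
    have card_a': "card (Poly_Mapping.keys a') < card (Poly_Mapping.keys a)"
      by (rule psubset_card_mono) (use i in \<open>auto simp: keys_a' degs_def\<close>)
    have card_b': "card (Poly_Mapping.keys b') < card (Poly_Mapping.keys b)"
      by (rule psubset_card_mono) (use j in \<open>auto simp: keys_b' degs_def\<close>)
    have deg_a': "int (mon_degree m) < i" if "m \<in> Poly_Mapping.keys a'" for m
    proof -
      have "int (mon_degree m) \<le> i" unfolding i_def
        by (rule Max_ge) (use that in \<open>auto simp: keys_a' degs_def\<close>)
      then show ?thesis using that by (simp add: keys_a')
    qed
    have deg_b': "int (mon_degree m) < j" if "m \<in> Poly_Mapping.keys b'" for m
    proof -
      have "int (mon_degree m) \<le> j" unfolding j_def
        by (rule Max_ge) (use that in \<open>auto simp: keys_b' degs_def\<close>)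
      then show ?thesis using that by (simp add: keys_b')
    qed
    have deg_b: "int (mon_degree m) \<le> j" if "m \<in> Poly_Mapping.keys b" for m
      unfolding j_def by (rule Max_ge) (use that in \<open>auto simp: degs_def\<close>)
    have z: "hcomp (i + j) (p * q) = 0"
      if less: "\<And>m m'. m \<in> Poly_Mapping.keys p \<Longrightarrow> m' \<in> Poly_Mapping.keys q \<Longrightarrow> int (mon_degree m) + int (mon_degree m') < i + j"
      for p q :: "('a, 'b) mpoly"
    proof -
      have "int (mon_degree m) < i + j" if m: "m \<in> Poly_Mapping.keys (p * q)" for m
      proof -
        obtain m1 m2 where "m = m1 + m2" "m1 \<in> Poly_Mapping.keys p" "m2 \<in> Poly_Mapping.keys q"
          using keys_mult[of p q] m by blast
        with less[of m1 m2] show ?thesis by (simp add: mon_degree_add)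
      qed
      then have "Poly_Mapping.keys (hcomp (i + j) (p * q)) = {}" by (fastforce simp: keys_hcomp)
      then show ?thesis by simp
    qed
    have "a * b = hcomp i a * hcomp j b + hcomp i a * b' + a' * b"
      by (simp add: a'_def b'_def algebra_simps)
    moreover have "hcomp (i + j) (hcomp i a * b') = 0"
      by (rule z) (use deg_b' in \<open>fastforce simp: keys_hcomp\<close>)
    moreover have "hcomp (i + j) (a' * b) = 0"
      by (rule z) (use deg_a' deg_b in fastforce)
    ultimately have "hcomp (i + j) (a * b) = hcomp i a * hcomp j b"
      by (simp add: hcomp_add hcomp_of_homog[OF homog_mult[OF hcomp_homog hcomp_homog]])
    then have "hcomp i a * hcomp j b \<in> Q" using ideal_hcomp[OF Q less.prems, of "i + j"] by simp
    then consider "hcomp i a \<in> Q" | "hcomp j b \<in> Q" using pr[OF hcomp_homog hcomp_homog] by blast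
    then show ?thesis
    proof cases
      case 1
      have "a' * b = a * b - b * hcomp i a" by (simp add: a'_def algebra_simps)
      then have "a' * b \<in> Q" using ideal_diff[OF Q less.prems ideal_mult[OF Q 1, of b]] by simp
      then have "a' \<in> Q \<or> b \<in> Q" using less.hyps[of a' b] card_a' by simp
      then show ?thesis using ideal_add[OF Q _ 1, of a'] by (auto simp: a'_def)
    next
      case 2
      have "a * b' = a * b - a * hcomp j b" by (simp add: b'_def algebra_simps)
      then have "a * b' \<in> Q" using ideal_diff[OF Q less.prems ideal_mult[OF Q 2, of a]] by simp
      then have "a \<in> Q \<or> b' \<in> Q" using less.hyps[of a b'] card_b' by simp
      then show ?thesis using ideal_add[OF Q _ 2, of b'] by (auto simp: b'_def)
    qed
  qed
qed

lemma module_self: "module ((*) :: 'a::comm_ring_1 \<Rightarrow> 'a \<Rightarrow> 'a)"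
  by unfold_locales (simp_all add: algebra_simps)

lemma one_notin_independent_mod: "independent_mod A I \<Longrightarrow> 1 \<notin> I"
  by (auto simp: independent_mod_def)

text \<open>A homogeneous ideal maximal among those containing \<open>I\<close> and meeting \<open>K[A]\<close> only in \<open>0\<close> is prime: if
  forms \<open>a, b\<close> lie outside \<open>Q\<close>, then both \<open>Q + (a)\<close> and \<open>Q + (b)\<close> contain nonzero elements of \<open>K[A]\<close>. Their
  product is a nonzero element of \<open>K[A]\<close> in \<open>Q + (a b)\<close>, so \<open>a b\<close> is not in \<open>Q\<close>.\<close>

lemma exists_homogeneous_prime:
  fixes I :: "('x::finite, 'k::field) mpoly set"
  assumes I: "homogeneous_ideal I" and ind: "independent_mod A I"
  obtains Q where "homogeneous_ideal Q" "prime_ideal Q" "I \<subseteq> Q" "independent_mod A Q"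
proof -
  define \<F> where "\<F> = {J. homogeneous_ideal J \<and> I \<subseteq> J \<and> independent_mod A J}"
  have "\<exists>Q\<in>\<F>. \<forall>X\<in>\<F>. Q \<subseteq> X \<longrightarrow> X = Q"
  proof (rule subset_Zorn_nonempty)
    show "\<F> \<noteq> {}" using I ind by (auto simp: \<F>_def)
  next
    fix C assume "C \<noteq> {}" and C: "subset.chain \<F> C"
    then have CF: "C \<subseteq> \<F>" by (simp add: subset.chain_def)
    have dir: "\<exists>J\<in>C. p \<in> J \<and> q \<in> J" if pq: "p \<in> \<Union>C" "q \<in> \<Union>C" for p q
    proof -
      obtain X Y where XY: "X \<in> C" "p \<in> X" "Y \<in> C" "q \<in> Y" using pq by blast
      then have "X \<subseteq> Y \<or> Y \<subseteq> X" using C by (auto simp: subset.chain_def)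
      then show ?thesis using XY by blast
    qed
    have hom: "homogeneous_ideal J" if "J \<in> C" for J using that CF by (auto simp: \<F>_def)
    have "homogeneous_ideal (\<Union>C)" unfolding homogeneous_ideal_def
    proof (intro conjI ballI allI)
      show "0 \<in> \<Union>C" using \<open>C \<noteq> {}\<close> ideal_0[OF hom] by blast
      show "p + q \<in> \<Union>C" if "p \<in> \<Union>C" "q \<in> \<Union>C" for p q
        using dir[OF that] ideal_add[OF hom] by blast
      show "p * q \<in> \<Union>C" if "q \<in> \<Union>C" for p q
        using that ideal_mult[OF hom] by blast
      show "hcomp j p \<in> \<Union>C" if "p \<in> \<Union>C" for p j
        using that ideal_hcomp[OF hom] by blast
    qed
    moreover have "independent_mod A (\<Union>C)"
      using CF by (auto simp: \<F>_def independent_mod_def)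
    moreover have "I \<subseteq> \<Union>C" using CF \<open>C \<noteq> {}\<close> by (auto simp: \<F>_def)
    ultimately show "\<Union>C \<in> \<F>" by (simp add: \<F>_def)
  qed
  then obtain Q where "Q \<in> \<F>" and max: "\<And>X. X \<in> \<F> \<Longrightarrow> Q \<subseteq> X \<Longrightarrow> X = Q" by blast
  then have Q: "homogeneous_ideal Q" and IQ: "I \<subseteq> Q" and indQ: "independent_mod A Q"
    by (auto simp: \<F>_def)
  \<comment> \<open>By maximality, adjoining any further form to \<open>Q\<close> creates a nonzero element of \<open>K[A]\<close>.\<close>
  have bigger: "\<exists>p r. p \<in> Q \<and> p + f * r \<noteq> 0 \<and> (\<forall>m\<in>Poly_Mapping.keys (p + f * r). Poly_Mapping.keys m \<subseteq> A)"
    if f: "f \<in> homog_part i" "f \<notin> Q" for f i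
  proof -
    let ?J = "{p + f * r | p r. p \<in> Q}"
    have J: "homogeneous_ideal ?J" by (rule ideal_adjoin[OF Q f(1)])
    have QJ: "Q \<subseteq> ?J"
    proof
      fix p assume "p \<in> Q"
      then show "p \<in> ?J" by (intro CollectI exI[of _ p] exI[of _ 0]) simp
    qed
    have "f \<in> ?J" using ideal_0[OF Q] by (intro CollectI exI[of _ 0] exI[of _ 1]) simp
    then have "?J \<notin> \<F>" using max[OF _ QJ] f(2) by blast
    then have "\<not> independent_mod A ?J" using J IQ QJ by (simp add: \<F>_def)
    then show ?thesis unfolding independent_mod_def by blast
  qed
  have "a \<in> Q \<or> b \<in> Q" if ab: "a \<in> homog_part i" "b \<in> homog_part j" "a * b \<in> Q" for a b i j
  proof (rule ccontr)
    assume "\<not> (a \<in> Q \<or> b \<in> Q)"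
    then obtain p r q t where
      p: "p \<in> Q" "p + a * r \<noteq> 0" "\<forall>m\<in>Poly_Mapping.keys (p + a * r). Poly_Mapping.keys m \<subseteq> A" and
      q: "q \<in> Q" "q + b * t \<noteq> 0" "\<forall>m\<in>Poly_Mapping.keys (q + b * t). Poly_Mapping.keys m \<subseteq> A"
      using bigger[OF ab(1)] bigger[OF ab(2)] by blast
    let ?u = "(p + a * r) * (q + b * t)"
    have "?u = (q + b * t) * p + a * r * q + (r * t) * (a * b)" by (simp add: algebra_simps)
    then have "?u \<in> Q" using p(1) q(1) ab(3) by (simp add: ideal_add[OF Q] ideal_mult[OF Q])
    moreover have "\<forall>m\<in>Poly_Mapping.keys ?u. Poly_Mapping.keys m \<subseteq> A"
    proof
      fix m assume "m \<in> Poly_Mapping.keys ?u"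
      then obtain m1 m2 where "m = m1 + m2" "m1 \<in> Poly_Mapping.keys (p + a * r)"
        "m2 \<in> Poly_Mapping.keys (q + b * t)"
        using keys_mult[of "p + a * r" "q + b * t"] by auto
      then show "Poly_Mapping.keys m \<subseteq> A" using p(3) q(3) Poly_Mapping.keys_add[of m1 m2] by blast
    qed
    ultimately have "?u = 0" using indQ by (auto simp: independent_mod_def)
    then show False using mpoly_mult_nonzero[OF p(2) q(2)] by simp
  qed
  note prime = prime_from_homogeneous_elements[OF Q this]
  have "module.subspace (*) Q"
    unfolding module.subspace_def[OF module_self]
    using ideal_0[OF Q] ideal_add[OF Q] ideal_mult[OF Q] by blast
  moreover have "Q \<noteq> UNIV" using one_notin_independent_mod[OF indQ] by blast
  ultimately have "prime_ideal Q" using prime by (auto simp: prime_ideal_def)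
  then show ?thesis using that Q IQ indQ by blast
qed

section \<open>Reduction modulo a homogeneous ideal\<close>

text \<open>Monomials with fewer than \<open>d\<close> exponents of size at least \<open>M\<close>: a thickening of the union of
  the coordinate subspaces of dimension \<open>d - 1\<close>.\<close>

definition reduced_mons :: "nat \<Rightarrow> nat \<Rightarrow> ('x::finite \<Rightarrow>\<^sub>0 nat) set" where
  "reduced_mons d M = {m. card {x. M \<le> Poly_Mapping.lookup m x} < d}"

lemma finite_bounded_mons: "finite {m :: 'x::finite \<Rightarrow>\<^sub>0 nat. \<forall>x. Poly_Mapping.lookup m x \<in> B x}"
  and card_bounded_mons: "card {m :: 'x::finite \<Rightarrow>\<^sub>0 nat. \<forall>x. Poly_Mapping.lookup m x \<in> B x} \<le> (\<Prod>x\<in>UNIV. card (B x))"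
  if "\<And>x. finite (B x)" for B
proof -
  let ?S = "{m :: 'x \<Rightarrow>\<^sub>0 nat. \<forall>x. Poly_Mapping.lookup m x \<in> B x}"
  have inj: "inj_on Poly_Mapping.lookup ?S" by (auto simp: inj_on_def intro: poly_mapping_eqI)
  have sub: "Poly_Mapping.lookup ` ?S \<subseteq> PiE UNIV B" by (auto simp: PiE_def)
  have fin: "finite (PiE UNIV B)" using that by (intro finite_PiE) auto
  show "finite ?S" using finite_subset[OF sub fin] inj by (rule finite_imageD)
  have "card ?S = card (Poly_Mapping.lookup ` ?S)" by (simp add: card_image[OF inj])
  also have "\<dots> \<le> card (PiE UNIV B)" by (rule card_mono[OF fin sub])
  also have "\<dots> = (\<Prod>x\<in>UNIV. card (B x))" by (simp add: card_PiE)
  finally show "card ?S \<le> (\<Prod>x\<in>UNIV. card (B x))" .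
qed

lemma finite_mons_degree_le: "finite {m :: 'x::finite \<Rightarrow>\<^sub>0 nat. mon_degree m \<le> j}"
  by (rule finite_subset[OF _ finite_bounded_mons[of "\<lambda>_. {..j}"]])
     (auto intro: order_trans[OF lookup_le_mon_degree])

text \<open>For each set \<open>A\<close> of \<open>d\<close> variables pick a nonzero form of \<open>I\<close> in these variables, and let \<open>M\<close> bound all
  exponents of the leading monomials. If a monomial has \<open>d\<close> exponents of size at least \<open>M\<close>, it is divisible by
  one of these leading monomials and can be replaced, modulo \<open>I\<close>, by smaller monomials of the
  same degree. There are finitely many of those, so the process ends.\<close>

lemma homogeneous_reduction:
  fixes I :: "('x::finite, 'k::field) mpoly set"
  assumes I: "homogeneous_ideal I" and dep: "\<And>A. card A = d \<Longrightarrow> \<not> independent_mod A I"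
  obtains M where "\<And>j p. p \<in> homog_part j \<Longrightarrow>
    \<exists>q\<in>homog_part j. p - q \<in> I \<and> Poly_Mapping.keys q \<subseteq> reduced_mons d M"
proof -
  have "\<exists>g i. card A = d \<longrightarrow> g \<in> I \<and> g \<noteq> 0 \<and> g \<in> homog_part i \<and> (\<forall>m\<in>Poly_Mapping.keys g. Poly_Mapping.keys m \<subseteq> A)" for A
  proof (cases "card A = d")
    case True
    then obtain p where p: "p \<in> I" "\<forall>m\<in>Poly_Mapping.keys p. Poly_Mapping.keys m \<subseteq> A" "p \<noteq> 0"
      using dep unfolding independent_mod_def by blast
    let ?i = "int (mon_degree (lead p))"
    have "lead p \<in> Poly_Mapping.keys (hcomp ?i p)" using lead_in_keys[OF p(3)] by (simp add: keys_hcomp)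
    then have "hcomp ?i p \<noteq> 0" by auto
    moreover have "hcomp ?i p \<in> I" by (rule ideal_hcomp[OF I p(1)])
    moreover have "\<forall>m\<in>Poly_Mapping.keys (hcomp ?i p). Poly_Mapping.keys m \<subseteq> A" using p(2) by (simp add: keys_hcomp)
    ultimately show ?thesis using hcomp_homog by blast
  qed auto
  then obtain g i where
    g: "\<And>A. card A = d \<Longrightarrow> g A \<in> I" "\<And>A. card A = d \<Longrightarrow> g A \<noteq> 0"
      "\<And>A. card A = d \<Longrightarrow> g A \<in> homog_part (i A)"
      "\<And>A m. card A = d \<Longrightarrow> m \<in> Poly_Mapping.keys (g A) \<Longrightarrow> Poly_Mapping.keys m \<subseteq> A"
    by metis
  define M where "M = (\<Sum>A\<in>UNIV. mon_degree (lead (g A)))"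
  have M: "Poly_Mapping.lookup (lead (g A)) x \<le> M" for A x
    using lookup_le_mon_degree[of "lead (g A)" x] member_le_sum[of A UNIV "\<lambda>A. mon_degree (lead (g A))"]
    by (simp add: M_def)
  \<comment> \<open>The forms of degree \<open>j\<close> that can be reduced.\<close>
  define good where "good j p \<longleftrightarrow> (\<exists>q\<in>homog_part j. p - q \<in> I \<and> Poly_Mapping.keys q \<subseteq> reduced_mons d M)"
    for j and p :: "('x, 'k) mpoly"
  have good_0: "good j 0" for j unfolding good_def by (rule bexI[of _ 0]) (use ideal_0[OF I] in auto)
  have good_add: "good j (p + q)" if "good j p" "good j q" for j p q
  proof -
    obtain p' q' where *: "p' \<in> homog_part j" "p - p' \<in> I" "Poly_Mapping.keys p' \<subseteq> reduced_mons d M"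
       "q' \<in> homog_part j" "q - q' \<in> I" "Poly_Mapping.keys q' \<subseteq> reduced_mons d M"
      using \<open>good j p\<close> \<open>good j q\<close> unfolding good_def by blast
    have eq: "p + q - (p' + q') = (p - p') + (q - q')" by simp
    have "p + q - (p' + q') \<in> I" unfolding eq by (rule ideal_add[OF I *(2,5)])
    then show ?thesis unfolding good_def using * Poly_Mapping.keys_add[of p' q']
      by (intro bexI[of _ "p' + q'"]) (auto intro: homog_add)
  qed
  have good_scale: "good j (const_poly c * p)" if gp: "good j p" for j c p
  proof -
    obtain p' where *: "p' \<in> homog_part j" "p - p' \<in> I" "Poly_Mapping.keys p' \<subseteq> reduced_mons d M"
      using gp unfolding good_def by blast
    have "const_poly c * p - const_poly c * p' = const_poly c * (p - p')" by (simp add: algebra_simps)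
    then have "const_poly c * p - const_poly c * p' \<in> I" using ideal_mult[OF I *(2)] by simp
    moreover have "Poly_Mapping.keys (const_poly c * p') \<subseteq> Poly_Mapping.keys p'" by (auto simp: in_keys_iff)
    ultimately show ?thesis unfolding good_def using *
      by (intro bexI[of _ "const_poly c * p'"]) (auto intro: homog_scale)
  qed
  have good_if_keys: "good j p" if good_keys: "\<And>m. m \<in> Poly_Mapping.keys p \<Longrightarrow> good j (xpow m)" for j p
  proof -
    have "good j (\<Sum>m\<in>S. const_poly (Poly_Mapping.lookup p m) * xpow m)"
      if "finite S" "S \<subseteq> Poly_Mapping.keys p" for S
      using that by (induction S rule: finite_induct) (auto intro!: good_0 good_add good_scale good_keys)
    from this[of "Poly_Mapping.keys p"] show ?thesis
      by (simp add: const_poly_times_xpow flip: mpoly_sum_singles)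
  qed
  have good_xpow: "good (int (mon_degree m)) (xpow m)" for m
  proof (induction "card {m' :: 'x \<Rightarrow>\<^sub>0 nat. mon_degree m' \<le> mon_degree m \<and> order_key m' < order_key m}" arbitrary: m rule: less_induct)
    case less
    show ?case
    proof (cases "m \<in> reduced_mons d M")
      case True
      then show ?thesis unfolding good_def
        by (intro bexI[of _ "xpow m"]) (use ideal_0[OF I] in \<open>auto simp: homog_single\<close>)
    next
      case False
      then have "d \<le> card {x. M \<le> Poly_Mapping.lookup m x}" by (simp add: reduced_mons_def)
      then obtain A where A: "A \<subseteq> {x. M \<le> Poly_Mapping.lookup m x}" "card A = d"
        by (meson obtain_subset_with_card_n)
      define e where "e = m - lead (g A)"
      have supp: "Poly_Mapping.keys (lead (g A)) \<subseteq> A" using g(4)[OF A(2) lead_in_keys[OF g(2)[OF A(2)]]] .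
      have le: "Poly_Mapping.lookup (lead (g A)) x \<le> Poly_Mapping.lookup m x" for x
      proof (cases "x \<in> A")
        case True
        then show ?thesis using A(1) M[of A x] by auto
      next
        case False
        then have "Poly_Mapping.lookup (lead (g A)) x = 0" using supp by (auto simp: in_keys_iff)
        then show ?thesis by simp
      qed
      have m: "m = e + lead (g A)"
        by (rule poly_mapping_eqI) (simp add: e_def lookup_add lookup_minus le)
      define lc where "lc = Poly_Mapping.lookup (g A) (lead (g A))"
      have lc: "lc \<noteq> 0" using lead_in_keys[OF g(2)[OF A(2)]] by (simp add: lc_def in_keys_iff)
      \<comment> \<open>A multiple of the chosen form with leading term exactly \<open>m\<close>.\<close>
      define h where "h = Poly_Mapping.single e (inverse lc) * g A"
      have hI: "h \<in> I" unfolding h_def by (rule ideal_mult[OF I g(1)[OF A(2)]])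
      have iA: "i A = int (mon_degree (lead (g A)))"
        using g(3)[OF A(2)] lead_in_keys[OF g(2)[OF A(2)]] by (simp add: homog_part_def)
      have h_hom: "h \<in> homog_part (int (mon_degree m))"
        using homog_mult[OF homog_single[of e "inverse lc"] g(3)[OF A(2)]] by (simp add: h_def m mon_degree_add iA)
      have nz: "Poly_Mapping.single e (inverse lc) \<noteq> 0" using lc
        by (metis lookup_single_eq lookup_zero nonzero_imp_inverse_nonzero)
      have "lead (Poly_Mapping.single e (inverse lc)) = e"
        using lead_in_keys[OF nz] lc by (simp split: if_splits)
      then have hm: "Poly_Mapping.lookup h m = 1"
        using lookup_lead_times[OF nz g(2)[OF A(2)]] lc by (simp add: h_def m lc_def)
      have hkeys: "order_key k \<le> order_key m" if k: "k \<in> Poly_Mapping.keys h" for k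
      proof -
        obtain b where b: "k = e + b" "b \<in> Poly_Mapping.keys (g A)"
          using keys_mult[of "Poly_Mapping.single e (inverse lc)" "g A"] k lc unfolding h_def
          by (auto split: if_splits)
        then show ?thesis using le_lead[OF g(2)[OF A(2)] b(2)] by (simp add: m order_key_add)
      qed
      have "good (int (mon_degree m)) (xpow m - h)"
      proof (rule good_if_keys)
        fix k assume k: "k \<in> Poly_Mapping.keys (xpow m - h)"
        have km: "k \<noteq> m" using k hm by (auto simp: in_keys_iff lookup_minus)
        then have kh: "k \<in> Poly_Mapping.keys h" using k by (auto simp: in_keys_iff lookup_minus lookup_single)
        have deg: "mon_degree k = mon_degree m" using h_hom kh by (auto simp: homog_part_def)
        have lt: "order_key k < order_key m" using hkeys[OF kh] km order_key_inject[of k m] by (simp add: order_le_less)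
        have "card {m' :: 'x \<Rightarrow>\<^sub>0 nat. mon_degree m' \<le> mon_degree k \<and> order_key m' < order_key k}
            < card {m' :: 'x \<Rightarrow>\<^sub>0 nat. mon_degree m' \<le> mon_degree m \<and> order_key m' < order_key m}"
        proof (rule psubset_card_mono)
          show "finite {m' :: 'x \<Rightarrow>\<^sub>0 nat. mon_degree m' \<le> mon_degree m \<and> order_key m' < order_key m}"
            by (rule finite_subset[OF _ finite_mons_degree_le[of "mon_degree m"]]) auto
          show "{m' :: 'x \<Rightarrow>\<^sub>0 nat. mon_degree m' \<le> mon_degree k \<and> order_key m' < order_key k}
            \<subset> {m' :: 'x \<Rightarrow>\<^sub>0 nat. mon_degree m' \<le> mon_degree m \<and> order_key m' < order_key m}"
          proof (rule psubsetI)
            show "{m' :: 'x \<Rightarrow>\<^sub>0 nat. mon_degree m' \<le> mon_degree k \<and> order_key m' < order_key k}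
              \<subseteq> {m'. mon_degree m' \<le> mon_degree m \<and> order_key m' < order_key m}"
            proof
              fix m' assume "m' \<in> {m' :: 'x \<Rightarrow>\<^sub>0 nat. mon_degree m' \<le> mon_degree k \<and> order_key m' < order_key k}"
              then have "mon_degree m' \<le> mon_degree m" "order_key m' < order_key k" by (simp_all only: mem_Collect_eq deg)
              from this(1) less_trans[OF this(2) lt]
              show "m' \<in> {m'. mon_degree m' \<le> mon_degree m \<and> order_key m' < order_key m}"
                by (simp only: mem_Collect_eq)
            qed
            have "k \<in> {m'. mon_degree m' \<le> mon_degree m \<and> order_key m' < order_key m}"
              using lt deg by (simp only: mem_Collect_eq order_refl)
            moreover have "k \<notin> {m'. mon_degree m' \<le> mon_degree k \<and> order_key m' < order_key k}"
              by (simp only: mem_Collect_eq less_irrefl simp_thms)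
            ultimately show "{m' :: 'x \<Rightarrow>\<^sub>0 nat. mon_degree m' \<le> mon_degree k \<and> order_key m' < order_key k}
              \<noteq> {m'. mon_degree m' \<le> mon_degree m \<and> order_key m' < order_key m}" by metis
          qed
        qed
        from less[OF this] show "good (int (mon_degree m)) (xpow k)" by (simp add: deg)
      qed
      then obtain q where "q \<in> homog_part (int (mon_degree m))" "xpow m - h - q \<in> I" "Poly_Mapping.keys q \<subseteq> reduced_mons d M"
        unfolding good_def by blast
      moreover from this have "xpow m - q \<in> I" using ideal_add[OF I _ hI, of "xpow m - h - q"] by simp
      ultimately show ?thesis unfolding good_def by blast
    qed
  qed
  have "good j p" if "p \<in> homog_part j" for j p
    by (rule good_if_keys) (use that good_xpow in \<open>fastforce simp: homog_part_def\<close>)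
  then show ?thesis using that unfolding good_def by blast
qed

text \<open>Classify a reduced monomial by the set of its large exponents: each of the at most \<open>d - 1\<close> large ones takes at
  most \<open>j + 1\<close> values, each other one at most \<open>M\<close>. The factor \<open>j + 1\<close> on the left avoids the exponent
  \<open>d - 1\<close>, so that \<open>d = 0\<close> (no reduced monomials at all) is covered.\<close>

lemma card_reduced_mons:
  "(j + 1) * card {m \<in> reduced_mons d M. mon_degree (m :: 'x::finite \<Rightarrow>\<^sub>0 nat) \<le> j}
    \<le> 2 ^ CARD('x) * (M + 1) ^ CARD('x) * (j + 1) ^ d"
proof (cases "d = 0")
  case True
  then show ?thesis by (simp add: reduced_mons_def)
next
  case False
  define B where "B A x = (if x \<in> A then {..j} else {..<M})" for A and x :: 'x
  define \<A> where "\<A> = {A :: 'x set. card A < d}"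
  define S where "S A = {m :: 'x \<Rightarrow>\<^sub>0 nat. \<forall>x. Poly_Mapping.lookup m x \<in> B A x}" for A
  have "{m \<in> reduced_mons d M. mon_degree m \<le> j} \<subseteq> (\<Union>A\<in>\<A>. S A)"
  proof
    fix m :: "'x \<Rightarrow>\<^sub>0 nat" assume m: "m \<in> {m \<in> reduced_mons d M. mon_degree m \<le> j}"
    then have "{x. M \<le> Poly_Mapping.lookup m x} \<in> \<A>" by (simp add: \<A>_def reduced_mons_def)
    moreover have "m \<in> S {x. M \<le> Poly_Mapping.lookup m x}"
      using m lookup_le_mon_degree[of m] by (auto simp: S_def B_def intro: order_trans)
    ultimately show "m \<in> (\<Union>A\<in>\<A>. S A)" by blast
  qed
  moreover have "finite (\<Union>A\<in>\<A>. S A)"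
    unfolding S_def by (intro finite_UN_I finite_bounded_mons) (simp_all add: B_def)
  ultimately have "card {m \<in> reduced_mons d M. mon_degree (m :: 'x \<Rightarrow>\<^sub>0 nat) \<le> j} \<le> card (\<Union>A\<in>\<A>. S A)"
    by (intro card_mono)
  also have "\<dots> \<le> (\<Sum>A\<in>\<A>. card (S A))" by (rule card_UN_le) simp
  also have "\<dots> \<le> (\<Sum>A\<in>\<A>. (j + 1) ^ (d - 1) * (M + 1) ^ CARD('x))"
  proof (rule sum_mono)
    fix A assume A: "A \<in> \<A>"
    have "card (S A) \<le> (\<Prod>x\<in>UNIV. card (B A x))"
      unfolding S_def by (rule card_bounded_mons) (simp add: B_def)
    also have "\<dots> = (\<Prod>x\<in>A. card (B A x)) * (\<Prod>x\<in>- A. card (B A x))"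
      using prod.union_disjoint[of A "- A" "\<lambda>x. card (B A x)"] by simp
    also have "(\<Prod>x\<in>A. card (B A x)) = (j + 1) ^ card A" by (simp add: B_def)
    also have "(\<Prod>x\<in>- A. card (B A x)) = M ^ card (- A)" by (simp add: B_def)
    also have "(j + 1) ^ card A * M ^ card (- A) \<le> (j + 1) ^ (d - 1) * (M + 1) ^ CARD('x)"
    proof (rule mult_mono)
      show "(j + 1) ^ card A \<le> (j + 1) ^ (d - 1)" using A by (intro power_increasing) (auto simp: \<A>_def)
      have "M ^ card (- A) \<le> (M + 1) ^ card (- A)" by (intro power_mono) auto
      also have "\<dots> \<le> (M + 1) ^ CARD('x)" by (intro power_increasing card_mono) auto
      finally show "M ^ card (- A) \<le> (M + 1) ^ CARD('x)" .
    qed auto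
    finally show "card (S A) \<le> (j + 1) ^ (d - 1) * (M + 1) ^ CARD('x)" .
  qed
  also have "\<dots> = card \<A> * ((j + 1) ^ (d - 1) * (M + 1) ^ CARD('x))" by simp
  also have "\<dots> \<le> 2 ^ CARD('x) * ((j + 1) ^ (d - 1) * (M + 1) ^ CARD('x))"
  proof (rule mult_right_mono)
    have "card \<A> \<le> card (UNIV :: 'x set set)" by (rule card_mono) auto
    also have "\<dots> = 2 ^ CARD('x)" using card_Pow[of "UNIV :: 'x set"] by simp
    finally show "card \<A> \<le> 2 ^ CARD('x)" .
  qed simp
  finally have "(j + 1) * card {m \<in> reduced_mons d M. mon_degree (m :: 'x \<Rightarrow>\<^sub>0 nat) \<le> j}
     \<le> (j + 1) * (2 ^ CARD('x) * ((j + 1) ^ (d - 1) * (M + 1) ^ CARD('x)))"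
    by (rule mult_left_mono) simp
  also have "\<dots> = 2 ^ CARD('x) * (M + 1) ^ CARD('x) * ((j + 1) * (j + 1) ^ (d - 1))" by (simp only: mult_ac)
  also have "(j + 1) * (j + 1) ^ (d - 1) = (j + 1) ^ d" using False by (cases d) auto
  finally show ?thesis .
qed

section \<open>Chains of primes\<close>

lemma vector_space_mpoly: "vector_space (\<lambda>c (p :: ('x, 'k::field) mpoly). const_poly c * p)"
  by unfold_locales (simp_all add: const_poly_add const_poly_mult algebra_simps)

text \<open>The monomials in \<open>B\<close> are linearly independent modulo \<open>I\<close>, and modulo \<open>I\<close> they lie in the span of \<open>T\<close>.\<close>

lemma card_le_of_reduction:
  fixes I :: "('x::finite, 'k::field) mpoly set"
  assumes I: "homogeneous_ideal I" and fin: "finite B" "finite T"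
    and ind: "\<And>p. p \<in> I \<Longrightarrow> Poly_Mapping.keys p \<subseteq> B \<Longrightarrow> p = 0"
    and red: "\<And>m. m \<in> B \<Longrightarrow> \<exists>q. xpow m - q \<in> I \<and> Poly_Mapping.keys q \<subseteq> T"
  shows "card B \<le> card T"
proof -
  interpret V: vector_space "\<lambda>c (p :: ('x, 'k) mpoly). const_poly c * p" by (rule vector_space_mpoly)
  obtain q where q: "\<And>m. m \<in> B \<Longrightarrow> xpow m - q m \<in> I" "\<And>m. m \<in> B \<Longrightarrow> Poly_Mapping.keys (q m) \<subseteq> T"
    using red by metis
  have coeffs_zero: "c m = 0" if comb: "(\<Sum>m\<in>B. const_poly (c m) * q m) = 0" and "m \<in> B" for c m
  proof -
    let ?p = "\<Sum>m\<in>B. const_poly (c m) * xpow m"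
    have lk: "Poly_Mapping.lookup ?p k = (if k \<in> B then c k else 0)" for k
      by (simp add: const_poly_times_xpow lookup_sum lookup_single when_def fin)
    have "?p = (\<Sum>m\<in>B. const_poly (c m) * (xpow m - q m))"
      using comb by (simp add: right_diff_distrib sum_subtractf)
    also have "\<dots> \<in> I" by (intro ideal_sum[OF I] ideal_mult[OF I] q)
    finally have "?p = 0" by (rule ind) (auto simp: in_keys_iff lk split: if_splits)
    then show ?thesis using lk[of m] \<open>m \<in> B\<close> by simp
  qed
  have inj: "inj_on q B"
  proof (rule inj_onI)
    fix a b assume ab: "a \<in> B" "b \<in> B" "q a = q b"
    have "xpow a - xpow b = (xpow a - q a) - (xpow b - q b)" using ab(3) by simp
    then have "(xpow a - xpow b :: ('x, 'k) mpoly) \<in> I" using ideal_diff[OF I q(1)[OF ab(1)] q(1)[OF ab(2)]] by simp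
    then have "(xpow a - xpow b :: ('x, 'k) mpoly) = 0"
      by (rule ind) (use ab in \<open>auto simp: in_keys_iff lookup_minus lookup_single when_def split: if_splits\<close>)
    then show "a = b" by (metis eq_iff_diff_eq_0 lookup_single_eq lookup_single_not_eq zero_neq_one)
  qed
  have "V.independent (q ` B)"
    unfolding V.dependent_finite[OF finite_imageI[OF fin(1)]]
  proof (intro notI, elim exE conjE bexE)
    fix u v assume v: "v \<in> q ` B" "u v \<noteq> 0" and "(\<Sum>v\<in>q ` B. const_poly (u v) * v) = 0"
    then have "(\<Sum>m\<in>B. const_poly (u (q m)) * q m) = 0" by (simp add: sum.reindex[OF inj])
    from coeffs_zero[OF this] v show False by auto
  qed
  moreover have "q ` B \<subseteq> V.span (xpow ` T)"
  proof
    fix p assume "p \<in> q ` B"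
    then have keys: "Poly_Mapping.keys p \<subseteq> T" using q(2) by auto
    have "p = (\<Sum>m\<in>Poly_Mapping.keys p. const_poly (Poly_Mapping.lookup p m) * xpow m)"
      by (simp add: const_poly_times_xpow flip: mpoly_sum_singles)
    also have "\<dots> \<in> V.span (xpow ` T)"
      by (intro V.span_sum V.span_scale V.span_base) (use keys in auto)
    finally show "p \<in> V.span (xpow ` T)" .
  qed
  ultimately have "card (q ` B) \<le> card (xpow ` T :: ('x, 'k) mpoly set)"
    using V.independent_span_bound[OF finite_imageI[OF fin(2)]] by blast
  also have "\<dots> \<le> card T" by (rule card_image_le[OF fin(2)])
  finally show ?thesis by (simp add: card_image[OF inj])
qed

text \<open>Choose \<open>d\<close> of the exponents freely in \<open>{0..q}\<close>; the last variable makes up the missing degree.\<close>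

lemma many_mons:
  fixes A :: "'x::finite set"
  assumes "card A = Suc d"
  shows "(q + 1) ^ d \<le> card {m. Poly_Mapping.keys m \<subseteq> A \<and> mon_degree m = Suc d * q}"
proof -
  obtain a where a: "a \<in> A" using assms by (metis card.empty equals0I nat.distinct(1))
  define A' where "A' = A - {a}"
  have cA': "card A' = d" using a assms by (simp add: A'_def)
  define F where "F = PiE A' (\<lambda>_. {..q})"
  define mon where "mon f = (\<Sum>x\<in>A'. Poly_Mapping.single x (f x)) + Poly_Mapping.single a (Suc d * q - sum f A')" for f
  have lk: "Poly_Mapping.lookup (mon f) x = f x" if "x \<in> A'" for f x
    using that by (auto simp: mon_def lookup_add lookup_sum lookup_single when_def A'_def)
  have "inj_on mon F"
  proof (rule inj_onI)
    fix f g assume fg: "f \<in> F" "g \<in> F" "mon f = mon g"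
    then have "f x = g x" if "x \<in> A'" for x using lk[OF that] by metis
    then show "f = g" using fg unfolding F_def by (intro PiE_ext) auto
  qed
  moreover have "mon ` F \<subseteq> {m. Poly_Mapping.keys m \<subseteq> A \<and> mon_degree m = Suc d * q}"
  proof
    fix m assume "m \<in> mon ` F"
    then obtain f where f: "f \<in> F" "m = mon f" by auto
    have "sum f A' \<le> (\<Sum>x\<in>A'. q)" by (rule sum_mono) (use f in \<open>auto simp: F_def\<close>)
    then have le: "sum f A' \<le> Suc d * q" by (simp add: cA')
    have degsum: "mon_degree (sum h S) = (\<Sum>x\<in>S. mon_degree (h x))" for h :: "'x \<Rightarrow> 'x \<Rightarrow>\<^sub>0 nat" and S
      by (induction S rule: infinite_finite_induct) (auto simp: mon_degree_add)
    have "mon_degree m = sum f A' + (Suc d * q - sum f A')"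
      unfolding f mon_def mon_degree_add degsum by (simp only: mon_degree_single)
    then have "mon_degree m = Suc d * q" using le by linarith
    moreover have "x \<in> A" if "x \<in> Poly_Mapping.keys m" for x
    proof (rule ccontr)
      assume "x \<notin> A"
      then have "Poly_Mapping.lookup (mon f) x = 0"
        using a unfolding mon_def lookup_add lookup_sum lookup_single A'_def by (auto simp: when_def)
      then show False using that f by (simp add: in_keys_iff)
    qed
    ultimately show "m \<in> {m. Poly_Mapping.keys m \<subseteq> A \<and> mon_degree m = Suc d * q}" by blast
  qed
  moreover have "finite {m. Poly_Mapping.keys m \<subseteq> A \<and> mon_degree m = Suc d * q}"
    by (rule finite_subset[OF _ finite_mons_degree_le[of "Suc d * q"]]) auto
  ultimately have "card F \<le> card {m. Poly_Mapping.keys m \<subseteq> A \<and> mon_degree m = Suc d * q}"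
    using card_image[of mon F] card_mono[of "{m. Poly_Mapping.keys m \<subseteq> A \<and> mon_degree m = Suc d * q}" "mon ` F"]
    by simp
  moreover have "card F = (q + 1) ^ d" unfolding F_def by (simp add: card_PiE cA')
  ultimately show ?thesis by (simp only:)
qed

definition var :: "'x::finite \<Rightarrow> ('x, 'k::field) mpoly" where
  "var x = xpow (Poly_Mapping.single x 1)"

lemma homog_var: "var x \<in> homog_part 1"
  using homog_single[of "Poly_Mapping.single x 1"] by (simp add: var_def)

lemma keys_var_mult: "Poly_Mapping.keys (var x * q) \<subseteq> (\<lambda>m. Poly_Mapping.single x 1 + m) ` Poly_Mapping.keys q"
  using keys_mult[of "var x" q] by (auto simp: var_def)

text \<open>If no \<open>d\<close> variables were independent modulo \<open>I + (x)\<close>, forms could be reduced modulo this ideal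
  to monomials in \<open>reduced_mons d M\<close>; repeating this with the cofactor of \<open>x\<close>, each form of
  degree \<open>j\<close> reduces modulo \<open>I\<close> to monomials \<open>x\<^sup>k r\<close> with \<open>r\<close> reduced. These number \<open>O(j\<^bsup>d - 1\<^esup>)\<close>, while the \<open>d + 1\<close>
  variables in \<open>A\<close> have about \<open>j\<^sup>d\<close> monomials of degree \<open>j\<close>, all independent modulo \<open>I\<close>.\<close>

lemma hypersurface_section_independent:
  fixes I :: "('x::finite, 'k::field) mpoly set"
  assumes I: "homogeneous_ideal I" and ind: "independent_mod A I" and A: "card A = Suc d"
  obtains A' where "card A' = d" "independent_mod A' {p + var x * r | p r. p \<in> I}"
proof (rule ccontr)
  let ?J = "{p + var x * r | p r. p \<in> I}"
  assume "\<not> thesis"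
  then have dep: "\<And>A. card A = d \<Longrightarrow> \<not> independent_mod A ?J" using that by blast
  have J: "homogeneous_ideal ?J" by (rule ideal_adjoin[OF I homog_var])
  from homogeneous_reduction[OF J dep] obtain M where
    M: "\<And>j p. p \<in> homog_part j \<Longrightarrow> \<exists>q\<in>homog_part j. p - q \<in> ?J \<and> Poly_Mapping.keys q \<subseteq> reduced_mons d M"
    by blast
  define T where "T j = {m. mon_degree m = j \<and> (\<exists>k. \<exists>r\<in>reduced_mons d M. m = Poly_Mapping.single x k + r)}" for j
  define R where "R j = {m \<in> reduced_mons d M. mon_degree (m :: 'x \<Rightarrow>\<^sub>0 nat) \<le> j}" for j
  have finR: "finite (R j)" for j
    by (rule finite_subset[OF _ finite_mons_degree_le[of j]]) (auto simp: R_def)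
  have T_sub: "T j \<subseteq> (\<lambda>r. Poly_Mapping.single x (j - mon_degree r) + r) ` R j" for j
  proof
    fix m assume "m \<in> T j"
    then obtain k r where r: "m = Poly_Mapping.single x k + r" "r \<in> reduced_mons d M" "j = k + mon_degree r"
      by (auto simp: T_def mon_degree_add)
    then have "m = Poly_Mapping.single x (j - mon_degree r) + r" "r \<in> R j" by (simp_all add: R_def)
    then show "m \<in> (\<lambda>r. Poly_Mapping.single x (j - mon_degree r) + r) ` R j" by (rule image_eqI)
  qed
  have finT: "finite (T j)" for j using finite_subset[OF T_sub finite_imageI[OF finR]] .
  have cardT: "card (T j) \<le> card (R j)" for j
    using card_mono[OF finite_imageI[OF finR] T_sub] card_image_le[OF finR] by (rule order_trans)
  have red: "\<exists>q. p - q \<in> I \<and> Poly_Mapping.keys q \<subseteq> T j" if "p \<in> homog_part (int j)" for p j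
    using that
  proof (induction j arbitrary: p)
    case 0
    from M[OF 0] obtain q a r where q: "q \<in> homog_part 0" "Poly_Mapping.keys q \<subseteq> reduced_mons d M"
      and a: "a \<in> I" "p - q = a + var x * r" by auto
    have "p - q = hcomp 0 (p - q)" using homog_diff[of p 0 q] 0 q by (simp add: hcomp_of_homog)
    also have "\<dots> = hcomp 0 a + var x * hcomp (-1) r"
      using hcomp_mult_homog[OF homog_var, of 0 r x] by (simp add: a hcomp_add mult.commute)
    also have "hcomp (-1) r = 0" by (rule homog_negative[OF _ hcomp_homog]) simp
    finally have "p - q \<in> I" using ideal_hcomp[OF I a(1)] by simp
    moreover have "Poly_Mapping.keys q \<subseteq> T 0"
    proof
      fix m assume m: "m \<in> Poly_Mapping.keys q"
      then have "mon_degree m = 0" using q(1) by (auto simp: homog_part_def)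
      then show "m \<in> T 0" unfolding T_def using q(2) m
        by (intro CollectI conjI exI[of _ 0] bexI[of _ m]) auto
    qed
    ultimately show ?case by blast
  next
    case (Suc j)
    from M[OF Suc.prems] obtain q a r where q: "q \<in> homog_part (int (Suc j))" "Poly_Mapping.keys q \<subseteq> reduced_mons d M"
      and a: "a \<in> I" "p - q = a + var x * r" by auto
    have "p - q = hcomp (int (Suc j)) (p - q)" using homog_diff[OF Suc.prems q(1)] by (simp add: hcomp_of_homog)
    also have "\<dots> = hcomp (int (Suc j)) a + var x * hcomp (int j) r"
      using hcomp_mult_homog[OF homog_var, of "int (Suc j)" r x] by (simp add: a hcomp_add mult.commute)
    finally have pq: "p - q = hcomp (int (Suc j)) a + var x * hcomp (int j) r" .
    from Suc.IH[OF hcomp_homog] obtain q1 where q1: "hcomp (int j) r - q1 \<in> I" "Poly_Mapping.keys q1 \<subseteq> T j" by blast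
    have eq: "p - (q + var x * q1) = hcomp (int (Suc j)) a + var x * (hcomp (int j) r - q1)"
      using pq by (simp add: algebra_simps)
    have "p - (q + var x * q1) \<in> I"
      unfolding eq by (intro ideal_add[OF I] ideal_hcomp[OF I a(1)] ideal_mult[OF I q1(1)])
    moreover have "Poly_Mapping.keys (q + var x * q1) \<subseteq> T (Suc j)"
    proof
      fix m assume "m \<in> Poly_Mapping.keys (q + var x * q1)"
      then consider "m \<in> Poly_Mapping.keys q" | "m \<in> Poly_Mapping.keys (var x * q1)"
        using Poly_Mapping.keys_add[of q "var x * q1"] by auto
      then show "m \<in> T (Suc j)"
      proof cases
        case 1
        then have "mon_degree m = Suc j" using q(1) by (auto simp: homog_part_def)
        then show ?thesis unfolding T_def using q(2) 1
          by (intro CollectI conjI exI[of _ 0] bexI[of _ m]) auto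
      next
        case 2
        then obtain m' where m': "m = Poly_Mapping.single x 1 + m'" "m' \<in> T j"
          using keys_var_mult[of x q1] q1(2) by auto
        then obtain k r where "m' = Poly_Mapping.single x k + r" "r \<in> reduced_mons d M" "mon_degree m' = j"
          unfolding T_def by auto
        then show ?thesis unfolding T_def m'(1)
          by (intro CollectI conjI exI[of _ "Suc k"] bexI[of _ r]) 
             (auto simp: mon_degree_add simp flip: single_add add.assoc)
      qed
    qed
    ultimately show ?case by blast
  qed
  define C where "C = 2 ^ CARD('x) * (M + 1) ^ CARD('x)"
  \<comment> \<open>Compare both counts in degree \<open>(d + 1) q\<close> and cancel \<open>(q + 1)\<^sup>d\<close>.\<close>
  have main: "Suc d * q + 1 \<le> C * (Suc d) ^ d" for q
  proof -
    let ?j = "Suc d * q"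
    let ?B = "{m. Poly_Mapping.keys m \<subseteq> A \<and> mon_degree m = ?j}"
    have finB: "finite ?B"
      by (rule finite_subset[OF _ finite_mons_degree_le[of ?j]]) auto
    have "card ?B \<le> card (T ?j)"
    proof (rule card_le_of_reduction[OF I finB finT])
      fix p assume "p \<in> I" "Poly_Mapping.keys p \<subseteq> ?B"
      then show "p = 0" using ind unfolding independent_mod_def by blast
    next
      fix m assume "m \<in> ?B"
      then show "\<exists>q. xpow m - q \<in> I \<and> Poly_Mapping.keys q \<subseteq> T ?j"
        by (intro red) (auto simp: homog_part_def)
    qed
    then have "(q + 1) ^ d \<le> card (R ?j)"
      using many_mons[OF A, of q] cardT[of ?j] by linarith
    then have "(?j + 1) * (q + 1) ^ d \<le> (?j + 1) * card (R ?j)" by (rule mult_left_mono) simp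
    also have "\<dots> \<le> C * (?j + 1) ^ d" unfolding R_def C_def by (rule card_reduced_mons)
    also have "\<dots> \<le> C * (Suc d * (q + 1)) ^ d" by (intro mult_left_mono power_mono) auto
    also have "\<dots> = C * Suc d ^ d * (q + 1) ^ d" by (simp only: power_mult_distrib mult.assoc)
    finally have "(?j + 1) * (q + 1) ^ d \<le> C * Suc d ^ d * (q + 1) ^ d" .
    moreover have "0 < (q + 1) ^ d" by simp
    ultimately show ?thesis by (simp only: mult_le_cancel2 simp_thms)
  qed
  have "X < Suc d * X + 1" for X by (induction X) auto
  then show False using main[of "C * Suc d ^ d"] by (simp only: not_le[symmetric])
qed

text \<open>The variable \<open>a \<in> A\<close> added at each step lies outside the prime \<open>Q\<close>, because \<open>Q\<close> avoids \<open>K[A]\<close>; this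
  makes the inclusions strict.\<close>

lemma prime_chain_of_independent:
  fixes I :: "('x::finite, 'k::field) mpoly set"
  assumes "homogeneous_ideal I" "independent_mod A I" "card A = d"
  shows "\<exists>P. (\<forall>i\<le>d. prime_ideal (P i) \<and> I \<subseteq> P i) \<and> (\<forall>i<d. P i \<subset> P (Suc i))"
  using assms
proof (induction d arbitrary: A I)
  case 0
  obtain Q where "prime_ideal Q" "I \<subseteq> Q"
    using exists_homogeneous_prime[OF 0(1,2)] by metis
  then show ?case by (intro exI[of _ "\<lambda>_. Q"]) simp
next
  case (Suc d)
  obtain Q where Q: "homogeneous_ideal Q" "prime_ideal Q" "I \<subseteq> Q" "independent_mod A Q"
    using exists_homogeneous_prime[OF Suc.prems(1,2)] by metis
  obtain a where a: "a \<in> A" using Suc.prems(3) by (metis card.empty equals0I nat.distinct(1))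
  let ?J = "{p + var a * r | p r. p \<in> Q}"
  obtain A' where A': "card A' = d" "independent_mod A' ?J"
    by (rule hypersurface_section_independent[OF Q(1,4) Suc.prems(3)])
  obtain P where P: "\<And>i. i \<le> d \<Longrightarrow> prime_ideal (P i) \<and> ?J \<subseteq> P i" "\<And>i. i < d \<Longrightarrow> P i \<subset> P (Suc i)"
    using Suc.IH[OF ideal_adjoin[OF Q(1) homog_var] A'(2,1)] by blast
  have QJ: "Q \<subseteq> ?J"
  proof
    fix p assume "p \<in> Q"
    then show "p \<in> ?J" by (intro CollectI exI[of _ p] exI[of _ 0]) simp
  qed
  have aJ: "var a \<in> ?J" using ideal_0[OF Q(1)] by (intro CollectI exI[of _ 0] exI[of _ 1]) simp
  have aQ: "var a \<notin> Q"
  proof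
    assume "var a \<in> Q"
    then have "var a = (0 :: ('x, 'k) mpoly)" using Q(4) a by (auto simp: independent_mod_def var_def)
    then show False by (metis lookup_single_eq lookup_zero var_def zero_neq_one)
  qed
  define P' where "P' i = (case i of 0 \<Rightarrow> Q | Suc k \<Rightarrow> P k)" for i
  have "prime_ideal (P' i) \<and> I \<subseteq> P' i" if "i \<le> Suc d" for i
  proof (cases i)
    case 0
    then show ?thesis using Q by (simp add: P'_def)
  next
    case (Suc k)
    then have "prime_ideal (P k)" "?J \<subseteq> P k" using P(1)[of k] that by auto
    then show ?thesis using QJ Q(3) Suc by (auto simp: P'_def)
  qed
  moreover have "P' i \<subset> P' (Suc i)" if "i < Suc d" for i
  proof (cases i)
    case 0
    then show ?thesis using P(1)[of 0] QJ aJ aQ by (auto simp: P'_def)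
  next
    case (Suc k)
    then show ?thesis using P(2)[of k] that by (simp add: P'_def)
  qed
  ultimately show ?case by blast
qed

lemma krull_dim_ge_of_independent:
  assumes "homogeneous_ideal (annihilator scale)" "independent_mod A (annihilator scale)"
  shows "enat (card A) \<le> krull_dim scale"
  unfolding krull_dim_def
  by (rule Sup_upper) (use prime_chain_of_independent[OF assms refl] in blast)

section \<open>Dimensions along a resolution\<close>

text \<open>Rank and nullity for a map that is linear only on a subspace \<open>V\<close>. Differentials of a resolution are
  specified only on the free module, not on the ambient type; the proof replaces \<open>f\<close> by a globally linear map that
  agrees with it on \<open>V\<close>.\<close>

lemma dim_eq_kernel_plus_image:
  assumes "vector_space s1" "vector_space s2" and V: "module.subspace s1 V"
    and fin: "finite F" "V \<subseteq> module.span s1 F"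
    and add: "\<And>u v. u \<in> V \<Longrightarrow> v \<in> V \<Longrightarrow> f (u + v) = f u + f v"
    and scale: "\<And>c v. v \<in> V \<Longrightarrow> f (s1 c v) = s2 c (f v)"
  shows "vector_space.dim s1 V = vector_space.dim s1 {v \<in> V. f v = 0} + vector_space.dim s2 (f ` V)"
proof -
  interpret vs1: vector_space s1 by fact
  interpret vs2: vector_space s2 by fact
  interpret vector_space_pair s1 s2 ..
  let ?K = "{v \<in> V. f v = 0}"
  obtain B where B: "B \<subseteq> ?K" "vs1.independent B" "?K \<subseteq> vs1.span B" "card B = vs1.dim ?K"
    by (rule vs1.basis_exists)
  obtain C where C: "B \<subseteq> C" "C \<subseteq> V" "vs1.independent C" "V \<subseteq> vs1.span C"
    using vs1.maximal_independent_subset_extend[of B V] B by blast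
  have finC: "finite C"
    using vs1.independent_span_bound[OF fin(1) C(3)] C(2) fin(2) by blast
  obtain g where g: "Vector_Spaces.linear s1 s2 g" "\<And>x. x \<in> C \<Longrightarrow> g x = f x"
    using linear_independent_extend[OF C(3), of f] by blast
  interpret g: Vector_Spaces.linear s1 s2 g by (rule g(1))
  have f0: "f 0 = 0" using add[OF vs1.subspace_0[OF V] vs1.subspace_0[OF V]] by simp
  have "vs1.subspace {v \<in> V. f v = g v}"
    unfolding vs1.subspace_def
    using vs1.subspace_0[OF V] vs1.subspace_add[OF V] vs1.subspace_scale[OF V]
    by (auto simp: f0 g.zero add g.add scale g.scale)
  then have "vs1.span C \<subseteq> {v \<in> V. f v = g v}"
    by (intro vs1.span_minimal) (use C(2) g(2) in auto)
  then have fg: "f v = g v" if "v \<in> V" for v using C(4) that by blast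
  have spanV: "vs1.span C = V" using C(2,4) vs1.span_minimal[OF C(2) V] by blast
  \<comment> \<open>The coordinates of such an \<open>x\<close> are supported in both \<open>B\<close> and \<open>C - B\<close>.\<close>
  have kernel_zero: "x = 0" if x: "x \<in> vs1.span (C - B)" "g x = 0" for x
  proof -
    have "x \<in> V" using x(1) vs1.span_mono[of "C - B" C] spanV by blast
    then have "x \<in> vs1.span B" using B(3) fg x(2) by auto
    then have rB: "vs1.representation C x = vs1.representation B x"
      by (rule vs1.representation_extend[OF C(3) _ C(1)])
    have rC: "vs1.representation C x = vs1.representation (C - B) x"
      by (rule vs1.representation_extend[OF C(3) x(1)]) blast
    have "vs1.representation C x b = 0" for b
      using vs1.representation_ne_zero[of B x b] vs1.representation_ne_zero[of "C - B" x b] rB rC by auto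
    then show ?thesis
      using vs1.sum_nonzero_representation_eq[OF C(3), of x] \<open>x \<in> V\<close> spanV by simp
  qed
  have inj: "inj_on g (vs1.span (C - B))"
    by (subst linear_inj_on_iff_eq_0[OF g(1) vs1.subspace_span]) (use kernel_zero in blast)
  have indep: "vs2.independent (g ` (C - B))"
    by (rule linear_independent_injective_image[OF g(1) _ inj])
       (use vs1.independent_mono[OF C(3)] in blast)
  have "g ` V \<subseteq> vs2.span (g ` (C - B))"
  proof -
    have "g ` C \<subseteq> vs2.span (g ` (C - B))"
    proof
      fix y assume "y \<in> g ` C"
      then obtain c where c: "c \<in> C" "y = g c" by auto
      show "y \<in> vs2.span (g ` (C - B))"
      proof (cases "c \<in> B")
        case True
        then have "y = 0" using B(1) c g(2) by auto
        then show ?thesis by (simp add: vs2.span_zero)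
      qed (use c in \<open>auto intro: vs2.span_base\<close>)
    qed
    then have "vs2.span (g ` C) \<subseteq> vs2.span (g ` (C - B))" by (simp add: vs2.span_minimal)
    then show ?thesis using linear_span_image[OF g(1), of C] spanV by simp
  qed
  moreover have "g ` (C - B) \<subseteq> g ` V" using C(2) by blast
  ultimately have "card (g ` (C - B)) = vs2.dim (g ` V)"
    using vs2.basis_card_eq_dim[OF _ _ indep] by blast
  moreover have "card (g ` (C - B)) = card (C - B)"
    by (rule card_image) (rule inj_on_subset[OF inj vs1.span_superset])
  moreover have "card C = vs1.dim V" using vs1.basis_card_eq_dim[OF C(2,4,3)] .
  moreover have "card C = card B + card (C - B)"
    using card_Diff_subset[of B C] card_mono[OF finC C(1)] C(1) finite_subset[OF C(1) finC] by simp
  moreover have "g ` V = f ` V" using fg by auto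
  ultimately show ?thesis using B(4) by simp
qed

lemma sum_fun_eval: "(\<Sum>a\<in>A. f a) x = (\<Sum>a\<in>A. f a x)" for f :: "'a \<Rightarrow> 'b \<Rightarrow> 'c::comm_monoid_add"
  by (induction A rule: infinite_finite_induct) auto

text \<open>The Hilbert function of the polynomial ring. It depends only on the type of variables, which is
  passed as an argument.\<close>

definition hilb :: "'x::finite itself \<Rightarrow> int \<Rightarrow> nat" where
  "hilb _ j = card {m :: 'x \<Rightarrow>\<^sub>0 nat. int (mon_degree m) = j}"

lemma finite_mons_degree: "finite {m :: 'x::finite \<Rightarrow>\<^sub>0 nat. int (mon_degree m) = j}"
proof (rule finite_imageD)
  show "inj_on Poly_Mapping.lookup {m :: 'x \<Rightarrow>\<^sub>0 nat. int (mon_degree m) = j}"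
    by (auto simp: inj_on_def intro: poly_mapping_eqI)
  have "Poly_Mapping.lookup ` {m :: 'x \<Rightarrow>\<^sub>0 nat. int (mon_degree m) = j} \<subseteq> {f. range f \<subseteq> {..nat j}}"
    using lookup_le_mon_degree by fastforce
  moreover have "finite {f :: 'x \<Rightarrow> nat. range f \<subseteq> {..nat j}}"
    using finite_set_of_finite_funs[of "UNIV :: 'x set" "{..nat j}" undefined]
    by (rule rev_finite_subset) auto
  ultimately show "finite (Poly_Mapping.lookup ` {m :: 'x \<Rightarrow>\<^sub>0 nat. int (mon_degree m) = j})"
    by (rule finite_subset)
qed

abbreviation free_vs_scale :: "'k::field \<Rightarrow> (nat \<Rightarrow> ('x, 'k) mpoly) \<Rightarrow> nat \<Rightarrow> ('x, 'k) mpoly" where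
  "free_vs_scale c \<equiv> free_scale (const_poly c)"

lemma vector_space_free: "vector_space (free_vs_scale :: 'k::field \<Rightarrow> (nat \<Rightarrow> ('x, 'k) mpoly) \<Rightarrow> _)"
  by unfold_locales (auto simp: free_scale_def const_poly_add const_poly_mult algebra_simps fun_eq_iff)

lemma subspace_free_part:
  "module.subspace free_vs_scale (free_part b a j :: (nat \<Rightarrow> ('x::finite, 'k::field) mpoly) set)"
proof -
  interpret vector_space "free_vs_scale :: 'k \<Rightarrow> (nat \<Rightarrow> ('x, 'k) mpoly) \<Rightarrow> _" by (rule vector_space_free)
  show ?thesis unfolding subspace_def
    by (auto simp: free_part_def free_module_def free_scale_def homog_add homog_scale)
qed

lemma
  fixes b :: nat and a j :: int
  defines "V \<equiv> free_part b a j :: (nat \<Rightarrow> ('x::finite, 'k::field) mpoly) set"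
  shows free_part_finite_dim: "\<exists>F. finite F \<and> V \<subseteq> module.span free_vs_scale F"
    and dim_free_part: "vector_space.dim free_vs_scale V = b * hilb TYPE('x) (j - a)"
proof -
  interpret vs: vector_space "free_vs_scale :: 'k \<Rightarrow> (nat \<Rightarrow> ('x, 'k) mpoly) \<Rightarrow> _" by (rule vector_space_free)
  define H where "H = {m :: 'x \<Rightarrow>\<^sub>0 nat. int (mon_degree m) = j - a}"
  have finH: "finite H" unfolding H_def by (rule finite_mons_degree)
  define e :: "nat \<times> ('x \<Rightarrow>\<^sub>0 nat) \<Rightarrow> nat \<Rightarrow> ('x, 'k) mpoly"
    where "e = (\<lambda>(i, m) k. if k = i then xpow m else (0 :: ('x, 'k) mpoly))"
  let ?S = "{..<b} \<times> H"
  have lk: "Poly_Mapping.lookup ((\<Sum>x\<in>?S. free_vs_scale (u x) (e x)) k) m = (if k < b \<and> m \<in> H then u (k, m) else 0)"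
    for u k m
  proof -
    have "Poly_Mapping.lookup ((\<Sum>x\<in>?S. free_vs_scale (u x) (e x)) k) m
       = (\<Sum>x\<in>?S. if x = (k, m) then u x else 0)"
      unfolding sum_fun_eval lookup_sum
      by (rule sum.cong) (auto simp: free_scale_def e_def lookup_single when_def split: if_splits)
    then show ?thesis using finH by simp
  qed
  have inj: "inj_on e ?S"
  proof (rule inj_onI, clarify)
    fix i m i' m' assume "e (i, m) = e (i', m')"
    then have eq: "e (i, m) k = e (i', m') k" for k by simp
    have nz: "xpow m \<noteq> (0 :: ('x, 'k) mpoly)" for m :: "'x \<Rightarrow>\<^sub>0 nat"
      by (metis lookup_single_eq lookup_zero zero_neq_one)
    have "i = i'" using eq[of i] nz by (auto simp: e_def split: if_splits)
    then have "xpow m = (xpow m' :: ('x, 'k) mpoly)" using eq[of i] by (simp add: e_def)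
    then have "m = m'" by (metis lookup_single_eq lookup_single_not_eq zero_neq_one)
    with \<open>i = i'\<close> show "i = i' \<and> m = m'" by simp
  qed
  have indep: "vs.independent (e ` ?S)"
  proof (subst vs.dependent_finite)
    show "finite (e ` ?S)" using finH by simp
    show "\<not> (\<exists>u. (\<exists>v\<in>e ` ?S. u v \<noteq> 0) \<and> (\<Sum>v\<in>e ` ?S. free_vs_scale (u v) v) = 0)"
    proof (intro notI, elim exE conjE bexE)
      fix u v assume v: "v \<in> e ` ?S" "u v \<noteq> 0" and z: "(\<Sum>v\<in>e ` ?S. free_vs_scale (u v) v) = 0"
      obtain k m where km: "k < b" "m \<in> H" "v = e (k, m)" using v by auto
      have "(\<Sum>x\<in>?S. free_vs_scale (u (e x)) (e x)) = 0" using z by (simp add: sum.reindex[OF inj])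
      then have "u v = 0" using lk[of "\<lambda>x. u (e x)" k m] km by simp
      then show False using v by simp
    qed
  qed
  have sub: "e ` ?S \<subseteq> V"
    by (auto simp: V_def free_part_def free_module_def e_def homog_part_def H_def split: if_splits)
  have span: "V \<subseteq> vs.span (e ` ?S)"
  proof
    fix f assume f: "f \<in> V"
    have "f = (\<Sum>x\<in>?S. free_vs_scale (Poly_Mapping.lookup (f (fst x)) (snd x)) (e x))"
    proof (intro ext poly_mapping_eqI)
      fix k m
      show "Poly_Mapping.lookup (f k) m = Poly_Mapping.lookup ((\<Sum>x\<in>?S. free_vs_scale (Poly_Mapping.lookup (f (fst x)) (snd x)) (e x)) k) m"
        unfolding lk using f
        by (cases "k < b"; cases "m \<in> Poly_Mapping.keys (f k)")
           (auto simp: V_def free_part_def free_module_def homog_part_def H_def in_keys_iff)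
    qed
    also have "\<dots> \<in> vs.span (e ` ?S)"
      by (intro vs.span_sum vs.span_scale vs.span_base) auto
    finally show "f \<in> vs.span (e ` ?S)" .
  qed
  show "\<exists>F. finite F \<and> V \<subseteq> vs.span F" 
    by (intro exI[of _ "e ` ?S"]) (use span finH in simp)
  have "vs.dim V = card (e ` ?S)" using vs.basis_card_eq_dim[OF sub span indep] by simp
  also have "\<dots> = b * hilb TYPE('x) (j - a)"
    unfolding card_image[OF inj] card_cartesian_product card_lessThan by (simp add: H_def hilb_def)
  finally show "vs.dim V = b * hilb TYPE('x) (j - a)" .
qed

text \<open>A homogeneous element is its own only component, so components of any other decomposition agree with it.\<close>

lemma graded_component_unique:
  assumes gr: "graded_module scale N" and J: "finite J" "j \<in> J"
    and c: "\<And>l. l \<in> J \<Longrightarrow> c l \<in> N l" and v: "v \<in> N j" "(\<Sum>l\<in>J. c l) = v"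
  shows "c j = v"
proof -
  have N0: "0 \<in> N l" for l using gr unfolding graded_module_def by blast
  have ex1: "\<exists>!c. (\<forall>j. c j \<in> N j) \<and> finite {j. c j \<noteq> 0} \<and> v = (\<Sum>j | c j \<noteq> 0. c j)"
    using gr unfolding graded_module_def by blast
  define c1 where "c1 l = (if l \<in> J then c l else 0)" for l
  define c2 where "c2 l = (if l = j then v else 0)" for l
  have sub1: "{l. c1 l \<noteq> 0} \<subseteq> J" by (auto simp: c1_def)
  have "(\<Sum>l | c1 l \<noteq> 0. c1 l) = (\<Sum>l\<in>J. c1 l)"
    by (rule sum.mono_neutral_left) (use J sub1 in auto)
  also have "\<dots> = v" using v by (simp add: c1_def)
  finally have s1: "v = (\<Sum>l | c1 l \<noteq> 0. c1 l)" by simp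
  have "(\<Sum>l | c2 l \<noteq> 0. c2 l) = (\<Sum>l\<in>{j}. c2 l)"
    by (rule sum.mono_neutral_left) (auto simp: c2_def)
  then have s2: "v = (\<Sum>l | c2 l \<noteq> 0. c2 l)" by (simp add: c2_def)
  have "finite {l. c1 l \<noteq> 0}" using finite_subset[OF sub1 J(1)] .
  moreover have "finite {l. c2 l \<noteq> 0}" by (rule finite_subset[of _ "{j}"]) (auto simp: c2_def)
  moreover have "\<forall>l. c1 l \<in> N l" "\<forall>l. c2 l \<in> N l" using c v N0 by (auto simp: c1_def c2_def)
  ultimately have "c1 = c2" using ex1 s1 s2 by blast
  then show ?thesis using J(2) by (metis c1_def c2_def)
qed

definition free_hcomp :: "int \<Rightarrow> int \<Rightarrow> (nat \<Rightarrow> ('x::finite, 'k::field) mpoly) \<Rightarrow> nat \<Rightarrow> ('x, 'k) mpoly" where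
  "free_hcomp a j f = (\<lambda>k. hcomp (j - a) (f k))"

lemma free_hcomp_in_free_part: "f \<in> free_module b \<Longrightarrow> free_hcomp a j f \<in> free_part b a j"
  by (simp add: free_hcomp_def free_part_def free_module_def)

lemma free_part_subset: "free_part b a j \<subseteq> free_module b"
  by (auto simp: free_part_def)

lemma free_module_decompose:
  assumes f: "f \<in> free_module b"
  obtains J where "finite J" "j \<in> J" "f = (\<Sum>l\<in>J. free_hcomp a l f)"
proof -
  define J where "J = insert j (\<Union>k<b. (\<lambda>l. l + a) ` degs (f k))"
  have fin: "finite J" by (simp add: J_def)
  have "f = (\<Sum>l\<in>J. free_hcomp a l f)"
  proof
    fix k
    show "f k = (\<Sum>l\<in>J. free_hcomp a l f) k"
    proof (cases "k < b")
      case True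
      have "(\<Sum>l\<in>J. hcomp (l - a) (f k)) = (\<Sum>l\<in>(\<lambda>l. l - a) ` J. hcomp l (f k))"
        by (subst sum.reindex) (auto simp: inj_on_def)
      also have "\<dots> = f k"
        by (rule sum_hcomp) (use fin True in \<open>force simp: J_def\<close>)+
      finally show ?thesis by (simp add: sum_fun_eval free_hcomp_def)
    next
      case False
      then show ?thesis using f by (simp add: sum_fun_eval free_hcomp_def free_module_def)
    qed
  qed
  then show ?thesis using that[of J] fin by (simp add: J_def)
qed

lemma free_module_sum: "(\<And>l. l \<in> J \<Longrightarrow> h l \<in> free_module b) \<Longrightarrow> sum h J \<in> free_module b"
  by (induction J rule: infinite_finite_induct) (auto simp: free_module_def)

lemma graded_hom_sum:
  assumes h: "graded_hom b a scale N \<phi>" and J: "finite J" "\<And>l. l \<in> J \<Longrightarrow> h l \<in> free_module b"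
  shows "\<phi> (sum h J) = (\<Sum>l\<in>J. \<phi> (h l))"
proof -
  have add: "\<phi> (f + g) = \<phi> f + \<phi> g" if "f \<in> free_module b" "g \<in> free_module b" for f g
    using h that by (simp add: graded_hom_def)
  have z: "(0 :: nat \<Rightarrow> _) \<in> free_module b" by (simp add: free_module_def)
  have "\<phi> 0 = 0" using add[OF z z] by simp
  with J show ?thesis
    by (induction J rule: finite_induct) (auto simp: add free_module_sum)
qed

lemma graded_hom_image: "graded_hom b a scale N \<phi> \<Longrightarrow> \<phi> ` free_part b a j \<subseteq> N j"
  unfolding graded_hom_def by (elim conjE) (rule spec)

lemma graded_hom_surj_degreewise:
  assumes gr: "graded_module scale N" and h: "graded_hom b a scale N \<epsilon>"
    and surj: "\<epsilon> ` free_module b = UNIV"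
  shows "\<epsilon> ` free_part b a j = N j"
proof
  show "\<epsilon> ` free_part b a j \<subseteq> N j" using h by (simp add: graded_hom_def)
  show "N j \<subseteq> \<epsilon> ` free_part b a j"
  proof
    fix v assume v: "v \<in> N j"
    obtain g where g: "g \<in> free_module b" "v = \<epsilon> g" using surj by (metis UNIV_I imageE)
    obtain J where J: "finite J" "j \<in> J" "g = (\<Sum>l\<in>J. free_hcomp a l g)"
      by (rule free_module_decompose[OF g(1)])
    have comp: "free_hcomp a l g \<in> free_part b a l" for l by (rule free_hcomp_in_free_part[OF g(1)])
    have "(\<Sum>l\<in>J. \<epsilon> (free_hcomp a l g)) = v"
      using graded_hom_sum[OF h J(1), of "\<lambda>l. free_hcomp a l g"] subsetD[OF free_part_subset comp]
      by (simp only: g(2) J(3)[symmetric])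
    moreover have "\<epsilon> (free_hcomp a l g) \<in> N l" for l
      using graded_hom_image[OF h] comp by blast
    ultimately have "\<epsilon> (free_hcomp a j g) = v"
      by (intro graded_component_unique[OF gr J(1,2), where c = "\<lambda>l. \<epsilon> (free_hcomp a l g)"] v)
    then show "v \<in> \<epsilon> ` free_part b a j" using comp by blast
  qed
qed

text \<open>If a homogeneous element has a preimage, the component of matching degree of that preimage maps to it.
  This turns exactness of the resolution into exactness in each degree.\<close>

lemma graded_hom_free_image_degreewise:
  assumes h: "graded_hom b a free_scale (free_part b' a') \<phi>"
  shows "\<phi> ` free_part b a j = \<phi> ` free_module b \<inter> free_part b' a' j"
proof
  show "\<phi> ` free_part b a j \<subseteq> \<phi> ` free_module b \<inter> free_part b' a' j"
    using graded_hom_image[OF h] free_part_subset by blast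
  show "\<phi> ` free_module b \<inter> free_part b' a' j \<subseteq> \<phi> ` free_part b a j"
  proof
    fix f assume "f \<in> \<phi> ` free_module b \<inter> free_part b' a' j"
    then obtain g where g: "g \<in> free_module b" "f = \<phi> g" and f: "f \<in> free_part b' a' j" by blast
    obtain J where J: "finite J" "j \<in> J" "g = (\<Sum>l\<in>J. free_hcomp a l g)"
      by (rule free_module_decompose[OF g(1)])
    have comp: "free_hcomp a l g \<in> free_part b a l" for l by (rule free_hcomp_in_free_part[OF g(1)])
    have sum: "f = (\<Sum>l\<in>J. \<phi> (free_hcomp a l g))"
      using graded_hom_sum[OF h J(1), of "\<lambda>l. free_hcomp a l g"] subsetD[OF free_part_subset comp]
      by (simp only: g(2) J(3)[symmetric])
    have img: "\<phi> (free_hcomp a l g) \<in> free_part b' a' l" for l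
      using graded_hom_image[OF h] comp by blast
    have "f k = \<phi> (free_hcomp a j g) k" for k
    proof (cases "k < b'")
      case True
      have hom: "\<phi> (free_hcomp a l g) k \<in> homog_part (l - a')" for l
        using img[of l] True by (simp add: free_part_def)
      have "f k = hcomp (j - a') (f k)" using f True hcomp_of_homog[of "f k" "j - a'" "j - a'"] by (simp add: free_part_def)
      also have "\<dots> = (\<Sum>l\<in>J. hcomp (j - a') (\<phi> (free_hcomp a l g) k))"
        by (subst sum) (simp add: sum_fun_eval hcomp_sum)
      also have "\<dots> = (\<Sum>l\<in>J. if l = j then \<phi> (free_hcomp a l g) k else 0)"
        by (rule sum.cong) (auto simp: hcomp_of_homog[OF hom])
      also have "\<dots> = \<phi> (free_hcomp a j g) k" using J by simp
      finally show ?thesis .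
    next
      case False
      then show ?thesis using f img[of j] by (simp add: free_part_def free_module_def)
    qed
    then have "f = \<phi> (free_hcomp a j g)" by blast
    then show "f \<in> \<phi> ` free_part b a j" using comp by blast
  qed
qed

lemma vector_space_of_module:
  assumes "module scale"
  shows "vector_space (\<lambda>c. scale (const_poly c))"
proof -
  interpret module scale by fact
  show ?thesis
    by unfold_locales (simp_all add: const_poly_add const_poly_mult scale_left_distrib scale_right_distrib)
qed

lemma dim_graded_hom:
  fixes \<phi> :: "(nat \<Rightarrow> ('x::finite, 'k::field) mpoly) \<Rightarrow> 'w::ab_group_add"
  assumes h: "graded_hom b a scale N \<phi>" and m: "vector_space (\<lambda>c. scale (const_poly c))"
  shows "b * hilb TYPE('x) (j - a) =
     vector_space.dim free_vs_scale {f \<in> free_part b a j. \<phi> f = 0}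
     + vector_space.dim (\<lambda>c. scale (const_poly c)) (\<phi> ` free_part b a j)"
proof -
  obtain F :: "(nat \<Rightarrow> ('x, 'k) mpoly) set" where F: "finite F" "free_part b a j \<subseteq> module.span free_vs_scale F"
    using free_part_finite_dim[of b a j] by blast
  have "vector_space.dim free_vs_scale (free_part b a j :: (nat \<Rightarrow> ('x, 'k) mpoly) set) =
     vector_space.dim free_vs_scale {f \<in> free_part b a j. \<phi> f = 0}
     + vector_space.dim (\<lambda>c. scale (const_poly c)) (\<phi> ` free_part b a j)"
  proof (rule dim_eq_kernel_plus_image[OF vector_space_free m subspace_free_part F])
    show "\<phi> (u + v) = \<phi> u + \<phi> v" if "u \<in> free_part b a j" "v \<in> free_part b a j" for u v
      using h that free_part_subset unfolding graded_hom_def by blast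
    show "\<phi> (free_vs_scale c v) = scale (const_poly c) (\<phi> v)" if "v \<in> free_part b a j" for c v
      using h that free_part_subset unfolding graded_hom_def by blast
  qed
  then show ?thesis by (simp add: dim_free_part)
qed

lemma pure_resolution_maps:
  fixes scale :: "('x::finite, 'k::field) mpoly \<Rightarrow> 'v::ab_group_add \<Rightarrow> 'v"
  assumes res: "pure_minimal_resolution scale N s \<beta> d"
  obtains \<epsilon> :: "(nat \<Rightarrow> ('x, 'k) mpoly) \<Rightarrow> 'v" and \<phi> :: "nat \<Rightarrow> (nat \<Rightarrow> ('x, 'k) mpoly) \<Rightarrow> nat \<Rightarrow> ('x, 'k) mpoly"
  where "graded_hom (\<beta> 0) (d 0) scale N \<epsilon>" "\<epsilon> ` free_module (\<beta> 0) = UNIV"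
    and "\<And>i. i < s \<Longrightarrow> graded_hom (\<beta> (Suc i)) (d (Suc i)) free_scale (free_part (\<beta> i) (d i)) (\<phi> (Suc i))"
    and "\<And>i. i \<le> s \<Longrightarrow> {f \<in> free_module (\<beta> i). if i = 0 then \<epsilon> f = 0 else \<phi> i f = 0} =
                (if i < s then \<phi> (Suc i) ` free_module (\<beta> (Suc i)) else {0})"
proof -
  obtain \<epsilon> :: "(nat \<Rightarrow> ('x, 'k) mpoly) \<Rightarrow> 'v" and \<phi> :: "nat \<Rightarrow> (nat \<Rightarrow> ('x, 'k) mpoly) \<Rightarrow> nat \<Rightarrow> ('x, 'k) mpoly"
    where res': "graded_hom (\<beta> 0) (d 0) scale N \<epsilon> \<and>
        (\<forall>i<s. graded_hom (\<beta> (Suc i)) (d (Suc i)) free_scale (free_part (\<beta> i) (d i)) (\<phi> (Suc i))) \<and>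
        \<epsilon> ` free_module (\<beta> 0) = UNIV \<and>
        (\<forall>i\<le>s. {f \<in> free_module (\<beta> i). if i = 0 then \<epsilon> f = 0 else \<phi> i f = 0} =
                (if i < s then \<phi> (Suc i) ` free_module (\<beta> (Suc i)) else {0})) \<and>
        (\<forall>i<s. \<forall>f\<in>free_module (\<beta> (Suc i)). \<forall>k. \<phi> (Suc i) f k \<in> irrelevant_ideal)"
    using res unfolding pure_minimal_resolution_def by (elim conjE[where ?P = "\<forall>i\<le>s. \<beta> i > 0"] exE)
  show ?thesis
  proof (rule that[OF res'[THEN conjunct1] res'[THEN conjunct2, THEN conjunct2, THEN conjunct1]])
    show "graded_hom (\<beta> (Suc i)) (d (Suc i)) free_scale (free_part (\<beta> i) (d i)) (\<phi> (Suc i))"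
      if "i < s" for i
      using res'[THEN conjunct2, THEN conjunct1] that by blast
    show "{f \<in> free_module (\<beta> i). if i = 0 then \<epsilon> f = 0 else \<phi> i f = 0} =
                (if i < s then \<phi> (Suc i) ` free_module (\<beta> (Suc i)) else {0})" if "i \<le> s" for i
      by (rule res'[THEN conjunct2, THEN conjunct2, THEN conjunct2, THEN conjunct1, rule_format, OF that])
  qed
qed

text \<open>In each degree the resolution is an exact sequence of finite-dimensional spaces. With \<open>z i\<close> the
  dimension of the \<open>i\<close>-th kernel, which is also that of the next image, the alternating sum telescopes.\<close>

lemma dim_graded_part:
  fixes scale :: "('x::finite, 'k::field) mpoly \<Rightarrow> 'v::ab_group_add \<Rightarrow> 'v"
  assumes gr: "graded_module scale N" and res: "pure_minimal_resolution scale N s \<beta> d"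
  shows "int (vector_space.dim (\<lambda>c. scale (const_poly c)) (N j)) =
    (\<Sum>k\<le>s. (-1) ^ k * int (\<beta> k) * int (hilb TYPE('x) (j - d k)))"
proof (rule pure_resolution_maps[OF res])
  fix \<epsilon> :: "(nat \<Rightarrow> ('x, 'k) mpoly) \<Rightarrow> 'v" and \<phi> :: "nat \<Rightarrow> (nat \<Rightarrow> ('x, 'k) mpoly) \<Rightarrow> nat \<Rightarrow> ('x, 'k) mpoly"
  assume eps: "graded_hom (\<beta> 0) (d 0) scale N \<epsilon>" "\<epsilon> ` free_module (\<beta> 0) = UNIV"
    and phi: "\<And>i. i < s \<Longrightarrow> graded_hom (\<beta> (Suc i)) (d (Suc i)) free_scale (free_part (\<beta> i) (d i)) (\<phi> (Suc i))"
    and exact: "\<And>i. i \<le> s \<Longrightarrow> {f \<in> free_module (\<beta> i). if i = 0 then \<epsilon> f = 0 else \<phi> i f = 0} =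
                (if i < s then \<phi> (Suc i) ` free_module (\<beta> (Suc i)) else {0})"
  have m: "vector_space (\<lambda>c. scale (const_poly c))"
    using gr unfolding graded_module_def by (intro vector_space_of_module) blast
  interpret free: vector_space "free_vs_scale :: 'k \<Rightarrow> (nat \<Rightarrow> ('x, 'k) mpoly) \<Rightarrow> _" by (rule vector_space_free)
  define z where "z i = vector_space.dim free_vs_scale
     {f \<in> free_part (\<beta> i) (d i) j. if i = 0 then \<epsilon> f = 0 else \<phi> i f = 0}" for i
  have ker: "{f \<in> free_part (\<beta> i) (d i) j. if i = 0 then \<epsilon> f = 0 else \<phi> i f = 0}
     = {f \<in> free_module (\<beta> i). if i = 0 then \<epsilon> f = 0 else \<phi> i f = 0} \<inter> free_part (\<beta> i) (d i) j" for i
    using free_part_subset by blast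
  have z_image: "z i = vector_space.dim free_vs_scale (\<phi> (Suc i) ` free_part (\<beta> (Suc i)) (d (Suc i)) j)"
    if "i < s" for i
    unfolding z_def ker graded_hom_free_image_degreewise[OF phi[OF that]] using exact[of i] that by simp
  have z_s: "z s = 0"
  proof -
    have "{f \<in> free_part (\<beta> s) (d s) j. if s = 0 then \<epsilon> f = 0 else \<phi> s f = 0} \<subseteq> {0}"
      unfolding ker using exact[of s] by simp
    also have "{0 :: nat \<Rightarrow> ('x, 'k) mpoly} \<subseteq> free.span {}" by simp
    finally show ?thesis
      unfolding z_def using free.dim_le_card[of _ "{}"] by simp
  qed
  have step0: "\<beta> 0 * hilb TYPE('x) (j - d 0) = z 0 + vector_space.dim (\<lambda>c. scale (const_poly c)) (N j)"
    using dim_graded_hom[OF eps(1) m, of j] graded_hom_surj_degreewise[OF gr eps] by (simp add: z_def)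
  have step: "\<beta> (Suc i) * hilb TYPE('x) (j - d (Suc i)) = z (Suc i) + z i" if "i < s" for i
    using dim_graded_hom[OF phi[OF that] vector_space_free, of j] z_image[OF that] by (simp add: z_def)
  have "(\<Sum>k\<le>t. (-1) ^ k * int (\<beta> k) * int (hilb TYPE('x) (j - d k))) =
      int (vector_space.dim (\<lambda>c. scale (const_poly c)) (N j)) + (-1) ^ t * int (z t)" if "t \<le> s" for t
    using that
  proof (induction t)
    case 0
    show ?case using arg_cong[OF step0, of int] by simp
  next
    case (Suc t)
    have "int (\<beta> (Suc t)) * int (hilb TYPE('x) (j - d (Suc t))) = int (z (Suc t)) + int (z t)"
      using arg_cong[OF step[of t], of int] Suc.prems by simp
    then have "(-1) ^ Suc t * int (\<beta> (Suc t)) * int (hilb TYPE('x) (j - d (Suc t)))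
        = (-1) ^ Suc t * int (z (Suc t)) + (-1) ^ Suc t * int (z t)"
      by (simp only: mult.assoc distrib_left)
    then show ?case using Suc by simp
  qed
  from this[of s] z_s show ?thesis by simp
qed

section \<open>Growth is bounded by the Krull dimension\<close>

text \<open>If \<open>p\<close> kills a homogeneous element \<open>v\<close>, then the products of the components of \<open>p\<close> with \<open>v\<close> have distinct degrees
  and sum to \<open>0\<close>, so each of them vanishes.\<close>

lemma homogeneous_ideal_annihilator:
  fixes scale :: "('x::finite, 'k::field) mpoly \<Rightarrow> 'v::ab_group_add \<Rightarrow> 'v"
  assumes gr: "graded_module scale N"
  shows "homogeneous_ideal (annihilator scale)"
proof -
  interpret module scale using gr unfolding graded_module_def by blast
  have hom: "scale p v \<in> N (i + j)" if "p \<in> homog_part i" "v \<in> N j" for p v i j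
    using gr that unfolding graded_module_def by blast
  have N0: "0 \<in> N j" for j using gr unfolding graded_module_def by blast
  have decomp: "\<exists>c. (\<forall>j. c j \<in> N j) \<and> v = (\<Sum>j | c j \<noteq> 0. c j)" for v
    using gr unfolding graded_module_def by blast
  have comp_zero: "scale (hcomp j p) v = 0" if p: "p \<in> annihilator scale" and v: "v \<in> N l" for p v j l
  proof (rule graded_component_unique[OF gr, where c = "\<lambda>l'. scale (hcomp (l' - l) p) v" and j = "j + l", simplified])
    let ?J = "(\<lambda>i. i + l) ` insert j (degs p)"
    show "finite ?J" by simp
    show "j + l \<in> ?J" by blast
    show "scale (hcomp (l' - l) p) v \<in> N l'" for l'
      using hom[OF hcomp_homog v, of "l' - l"] by simp
    show "0 \<in> N (j + l)" by (rule N0)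
    have "(\<Sum>l'\<in>?J. scale (hcomp (l' - l) p) v) = (\<Sum>i\<in>insert j (degs p). scale (hcomp i p) v)"
      by (subst sum.reindex) (auto simp: inj_on_def)
    also have "\<dots> = scale (\<Sum>i\<in>insert j (degs p). hcomp i p) v" by (simp only: scale_sum_left)
    also have "(\<Sum>i\<in>insert j (degs p). hcomp i p) = p" by (rule sum_hcomp) auto
    also have "scale p v = 0" using p by (simp add: annihilator_def)
    finally show "(\<Sum>l'\<in>?J. scale (hcomp (l' - l) p) v) = 0" .
  qed
  have "scale (hcomp j p) v = 0" if "p \<in> annihilator scale" for p v j
  proof -
    obtain c where c: "\<And>l. c l \<in> N l" "v = (\<Sum>l | c l \<noteq> 0. c l)" using decomp[of v] by blast
    have "scale (hcomp j p) v = (\<Sum>l | c l \<noteq> 0. scale (hcomp j p) (c l))"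
      by (subst c(2)) (rule scale_sum_right)
    then show ?thesis using comp_zero[OF that c(1)] by simp
  qed
  then show ?thesis
    unfolding homogeneous_ideal_def annihilator_def
    by (auto simp: scale_left_distrib simp flip: scale_scale)
qed

text \<open>As \<open>N\<close> is generated in degree \<open>0\<close> by \<open>b\<close> elements, each form acting on a generator can be reduced
  modulo the annihilator to the monomials in \<open>T\<close>.\<close>

lemma dim_graded_part_le:
  fixes scale :: "('x::finite, 'k::field) mpoly \<Rightarrow> 'v::ab_group_add \<Rightarrow> 'v"
  assumes gr: "graded_module scale N" and h: "graded_hom b 0 scale N \<epsilon>"
    and surj: "\<epsilon> ` free_module b = UNIV"
    and red: "\<And>p. p \<in> homog_part j \<Longrightarrow> \<exists>q. p - q \<in> annihilator scale \<and> Poly_Mapping.keys q \<subseteq> T"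
    and fin: "finite T"
  shows "vector_space.dim (\<lambda>c. scale (const_poly c)) (N j) \<le> b * card T"
proof -
  interpret module scale using gr unfolding graded_module_def by blast
  interpret vs: vector_space "\<lambda>c. scale (const_poly c)" by (rule vector_space_of_module) (rule module_axioms)
  define u :: "nat \<Rightarrow> nat \<Rightarrow> ('x, 'k) mpoly" where "u k l = (if l = k then 1 else 0)" for k l
  define G where "G = (\<lambda>(k, m). scale (xpow m) (\<epsilon> (u k))) ` ({..<b} \<times> T)"
  have hom_scale: "\<epsilon> (free_scale p f) = scale p (\<epsilon> f)" if "f \<in> free_module b" for p f
    using h that unfolding graded_hom_def by blast
  have uf: "u k \<in> free_module b" if "k < b" for k using that by (simp add: u_def free_module_def)
  have "N j \<subseteq> vs.span G"
  proof
    fix v assume "v \<in> N j"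
    then obtain f where f: "f \<in> free_part b 0 j" "v = \<epsilon> f"
      using graded_hom_surj_degreewise[OF gr h surj, of j] by blast
    have "f = (\<Sum>k<b. free_scale (f k) (u k))"
    proof
      fix l
      have "(\<Sum>k<b. f k * u k l) = (\<Sum>k<b. if k = l then f k else 0)"
        by (rule sum.cong) (auto simp: u_def)
      then show "f l = (\<Sum>k<b. free_scale (f k) (u k)) l"
        using f(1) by (auto simp: sum_fun_eval free_scale_def free_part_def free_module_def)
    qed
    moreover have "\<epsilon> (\<Sum>k<b. free_scale (f k) (u k)) = (\<Sum>k<b. \<epsilon> (free_scale (f k) (u k)))"
      by (rule graded_hom_sum[OF h]) (use uf in \<open>auto simp: free_scale_def free_module_def\<close>)
    ultimately have v: "v = (\<Sum>k<b. scale (f k) (\<epsilon> (u k)))"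
      using f(2) by (simp add: hom_scale uf)
    have "scale (f k) (\<epsilon> (u k)) \<in> vs.span G" if k: "k < b" for k
    proof -
      obtain q where q: "f k - q \<in> annihilator scale" "Poly_Mapping.keys q \<subseteq> T"
        using red[of "f k"] f(1) k by (auto simp: free_part_def)
      have "scale (f k) (\<epsilon> (u k)) = scale q (\<epsilon> (u k))"
        using q(1) scale_left_diff_distrib[of "f k" q "\<epsilon> (u k)"] by (simp add: annihilator_def)
      also have "q = (\<Sum>m\<in>Poly_Mapping.keys q. const_poly (Poly_Mapping.lookup q m) * xpow m)"
        by (simp add: const_poly_times_xpow flip: mpoly_sum_singles)
      also have "scale \<dots> (\<epsilon> (u k)) =
          (\<Sum>m\<in>Poly_Mapping.keys q. scale (const_poly (Poly_Mapping.lookup q m)) (scale (xpow m) (\<epsilon> (u k))))"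
        by (simp only: scale_sum_left scale_scale)
      also have "\<dots> \<in> vs.span G"
        by (intro vs.span_sum vs.span_scale vs.span_base) (use q(2) k in \<open>auto simp: G_def\<close>)
      finally show ?thesis .
    qed
    then show "v \<in> vs.span G" unfolding v by (intro vs.span_sum) auto
  qed
  moreover have "finite G" using fin by (simp add: G_def)
  ultimately have "vs.dim (N j) \<le> card G" by (rule vs.dim_le_card)
  also have "\<dots> \<le> card ({..<b} \<times> T)" unfolding G_def by (rule card_image_le) (use fin in simp)
  finally show ?thesis by (simp add: card_cartesian_product)
qed

lemma graded_part_negative:
  assumes gr: "graded_module scale N" and h: "graded_hom b 0 scale N \<epsilon>"
    and surj: "\<epsilon> ` free_module b = UNIV" and "j < 0"
  shows "N j = {0}"
proof -
  have "free_part b 0 j \<subseteq> {0}"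
  proof
    fix f assume f: "f \<in> free_part b 0 j"
    have "f k = 0" for k
      using f homog_negative[OF \<open>j < 0\<close>, of "f k"] by (cases "k < b") (auto simp: free_part_def free_module_def)
    then show "f \<in> {0}" by (simp add: fun_eq_iff)
  qed
  then have "N j \<subseteq> {\<epsilon> 0}" using graded_hom_surj_degreewise[OF gr h surj, of j] by blast
  moreover have "0 \<in> N j" using gr unfolding graded_module_def by blast
  ultimately show ?thesis by (metis emptyE singletonD subset_singletonD)
qed

text \<open>An interval of summation makes the sum exchangeable with the one over the resolution; the added pieces are zero.\<close>

lemma hilbert_sum_eq_sum_interval:
  assumes gr: "graded_module scale N" and neg: "\<And>j. j < 0 \<Longrightarrow> N j = {0}" and "L \<le> 0"
  shows "hilbert_sum scale N i = (\<Sum>j=L..i. vector_space.dim (\<lambda>c. scale (const_poly c)) (N j))"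
proof -
  interpret vs: vector_space "\<lambda>c. scale (const_poly c)"
    by (rule vector_space_of_module) (use gr in \<open>unfold graded_module_def, blast\<close>)
  have "{0} \<subseteq> vs.span {}" by simp
  then have dim0: "vs.dim {0} = 0" using vs.dim_le_card[of "{0}" "{}"] by simp
  have sub: "{j. j \<le> i \<and> N j \<noteq> {0}} \<subseteq> {L..i}" using neg \<open>L \<le> 0\<close> by force
  show ?thesis unfolding hilbert_sum_def
  proof (rule sum.mono_neutral_left)
    show "\<forall>j\<in>{L..i} - {j. j \<le> i \<and> N j \<noteq> {0}}. vs.dim (N j) = 0" using dim0 by auto
  qed (use sub in auto)
qed

text \<open>More than \<open>D\<close> variables independent modulo the annihilator would give too long a chain of primes.
  So the reduction applies with \<open>d = D + 1\<close>, and it bounds the dimensions of the graded pieces.\<close>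

lemma hilbert_sum_growth:
  fixes scale :: "('x::finite, 'k::field) mpoly \<Rightarrow> 'v::ab_group_add \<Rightarrow> 'v"
  assumes gr: "graded_module scale N" and h: "graded_hom b 0 scale N \<epsilon>"
    and surj: "\<epsilon> ` free_module b = UNIV" and krull: "krull_dim scale = enat D"
  obtains C where "\<And>i. hilbert_sum scale N (int i) \<le> C * (i + 1) ^ D"
proof -
  let ?I = "annihilator scale"
  have I: "homogeneous_ideal ?I" by (rule homogeneous_ideal_annihilator[OF gr])
  have dep: "\<not> independent_mod A ?I" if "card A = Suc D" for A
    using krull_dim_ge_of_independent[OF I, of A] that krull by auto
  obtain M where M: "\<And>j p. p \<in> homog_part j \<Longrightarrow>
      \<exists>q\<in>homog_part j. p - q \<in> ?I \<and> Poly_Mapping.keys q \<subseteq> reduced_mons (Suc D) M"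
    using homogeneous_reduction[OF I dep] by blast
  define R where "R j = {m \<in> reduced_mons (Suc D) M. int (mon_degree (m :: 'x \<Rightarrow>\<^sub>0 nat)) = j}" for j
  have finR: "finite (R j)" for j
    by (rule finite_subset[OF _ finite_mons_degree[of j]]) (auto simp: R_def)
  have dim_le: "vector_space.dim (\<lambda>c. scale (const_poly c)) (N j) \<le> b * card (R j)" for j
  proof (rule dim_graded_part_le[OF gr h surj _ finR])
    fix p :: "('x, 'k) mpoly" assume "p \<in> homog_part j"
    from M[OF this] obtain q where "q \<in> homog_part j" "p - q \<in> ?I" "Poly_Mapping.keys q \<subseteq> reduced_mons (Suc D) M"
      by blast
    then show "\<exists>q. p - q \<in> ?I \<and> Poly_Mapping.keys q \<subseteq> R j"
      by (intro exI[of _ q]) (auto simp: R_def homog_part_def)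
  qed
  define K where "K = 2 ^ CARD('x) * (M + 1) ^ CARD('x)"
  have "hilbert_sum scale N (int i) \<le> b * K * (i + 1) ^ D" for i
  proof -
    have "hilbert_sum scale N (int i) = (\<Sum>j=0..int i. vector_space.dim (\<lambda>c. scale (const_poly c)) (N j))"
      by (rule hilbert_sum_eq_sum_interval[OF gr graded_part_negative[OF gr h surj]]) simp_all
    also have "\<dots> \<le> (\<Sum>j=0..int i. b * card (R j))" by (rule sum_mono) (rule dim_le)
    also have "\<dots> = b * (\<Sum>j=0..int i. card (R j))" by (simp add: sum_distrib_left)
    also have "(\<Sum>j=0..int i. card (R j)) = card (\<Union>j\<in>{0..int i}. R j)"
      by (rule card_UN_disjoint[symmetric]) (use finR in \<open>auto simp: R_def\<close>)
    also have "(\<Union>j\<in>{0..int i}. R j) = {m \<in> reduced_mons (Suc D) M. mon_degree m \<le> i}"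
      by (auto simp: R_def)
    finally have le: "hilbert_sum scale N (int i) \<le> b * card {m \<in> reduced_mons (Suc D) M. mon_degree (m :: 'x \<Rightarrow>\<^sub>0 nat) \<le> i}" .
    have "K * (i + 1) ^ Suc D = (i + 1) * (K * (i + 1) ^ D)" by (simp only: power_Suc mult.left_commute)
    then have "(i + 1) * card {m \<in> reduced_mons (Suc D) M. mon_degree (m :: 'x \<Rightarrow>\<^sub>0 nat) \<le> i} \<le> (i + 1) * (K * (i + 1) ^ D)"
      using card_reduced_mons[of i "Suc D" M, where 'x = 'x] unfolding K_def by (simp only:)
    then have "card {m \<in> reduced_mons (Suc D) M. mon_degree (m :: 'x \<Rightarrow>\<^sub>0 nat) \<le> i} \<le> K * (i + 1) ^ D"
      by (subst (asm) mult_le_cancel1) simp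
    then have "b * card {m \<in> reduced_mons (Suc D) M. mon_degree (m :: 'x \<Rightarrow>\<^sub>0 nat) \<le> i} \<le> b * (K * (i + 1) ^ D)"
      by (rule mult_left_mono) simp
    from order_trans[OF le this] show ?thesis by (simp only: mult.assoc)
  qed
  then show ?thesis by (rule that)
qed

section \<open>The Hilbert polynomial of a pure resolution\<close>

text \<open>The missing degree serves as one more exponent, which identifies these monomials with the compositions of \<open>t\<close>
  into \<open>n + 1\<close> nonnegative parts.\<close>

lemma card_mons_degree_le: "card {m :: 'x::finite \<Rightarrow>\<^sub>0 nat. mon_degree m \<le> t} = (t + CARD('x)) choose CARD('x)"
proof -
  obtain xs :: "'x list" where xs: "set xs = UNIV" "distinct xs"
    using finite_distinct_list[of "UNIV :: 'x set"] by auto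
  have len: "length xs = CARD('x)" using distinct_card[OF xs(2)] xs(1) by simp
  define h where "h m = (t - mon_degree m) # map (Poly_Mapping.lookup m) xs" for m
  have deg: "sum_list (map (Poly_Mapping.lookup m) xs) = mon_degree m" for m
    using xs by (simp add: sum_list_distinct_conv_sum_set mon_degree_def)
  have "bij_betw h {m. mon_degree m \<le> t} {l. length l = CARD('x) + 1 \<and> sum_list l = t}"
  proof (rule bij_betw_imageI)
    show "inj_on h {m. mon_degree m \<le> t}"
      by (rule inj_onI, rule poly_mapping_eqI) (use xs(1) in \<open>auto simp: h_def map_eq_conv\<close>)
    show "h ` {m. mon_degree m \<le> t} = {l. length l = CARD('x) + 1 \<and> sum_list l = t}"
    proof (intro equalityI subsetI)
      fix l assume "l \<in> h ` {m. mon_degree m \<le> t}"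
      then show "l \<in> {l. length l = CARD('x) + 1 \<and> sum_list l = t}"
        using deg by (auto simp: h_def len)
    next
      fix l assume l: "l \<in> {l. length l = CARD('x) + 1 \<and> sum_list l = t}"
      then obtain a ys where ys: "l = a # ys" "length ys = length xs" by (cases l) (auto simp: len)
      define m where "m = Abs_poly_mapping (\<lambda>x. the (map_of (zip xs ys) x))"
      have lk: "Poly_Mapping.lookup m x = the (map_of (zip xs ys) x)" for x
        unfolding m_def by (subst lookup_Abs_poly_mapping) auto
      have m: "map (Poly_Mapping.lookup m) xs = ys"
        by (rule nth_equalityI) (use ys xs in \<open>auto simp: lk map_of_zip_nth\<close>)
      have "l = h m" "mon_degree m \<le> t" using l ys deg[of m] m by (auto simp: h_def)
      then show "l \<in> h ` {m. mon_degree m \<le> t}" by blast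
    qed
  qed
  then have "card {m :: 'x \<Rightarrow>\<^sub>0 nat. mon_degree m \<le> t} = card {l :: nat list. length l = CARD('x) + 1 \<and> sum_list l = t}"
    by (rule bij_betw_same_card)
  also have "\<dots> = (t + CARD('x)) choose t" by (simp add: card_length_sum_list)
  also have "\<dots> = (t + CARD('x)) choose CARD('x)" using binomial_symmetric[of t "t + CARD('x)"] by simp
  finally show ?thesis .
qed

lemma sum_hilb:
  assumes "L \<le> a" "a \<le> i"
  shows "of_nat (\<Sum>j=L..i. hilb TYPE('x::finite) (j - a)) = (of_int i + of_nat CARD('x) - of_int a :: rat) gchoose CARD('x)"
proof -
  have "(\<Sum>j=L..i. hilb TYPE('x) (j - a)) = card (\<Union>j\<in>{L..i}. {m :: 'x \<Rightarrow>\<^sub>0 nat. int (mon_degree m) = j - a})"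
    unfolding hilb_def by (rule card_UN_disjoint[symmetric]) (use finite_mons_degree in auto)
  also have "(\<Union>j\<in>{L..i}. {m :: 'x \<Rightarrow>\<^sub>0 nat. int (mon_degree m) = j - a}) = {m. mon_degree m \<le> nat (i - a)}"
  proof (intro equalityI subsetI)
    fix m :: "'x \<Rightarrow>\<^sub>0 nat" assume "m \<in> {m. mon_degree m \<le> nat (i - a)}"
    then show "m \<in> (\<Union>j\<in>{L..i}. {m. int (mon_degree m) = j - a})"
      using assms by (intro UN_I[of "int (mon_degree m) + a"]) auto
  qed (use assms in auto)
  finally have "(\<Sum>j=L..i. hilb TYPE('x) (j - a)) = (nat (i - a) + CARD('x)) choose CARD('x)"
    by (simp add: card_mons_degree_le)
  then have "of_nat (\<Sum>j=L..i. hilb TYPE('x) (j - a)) = (of_nat (nat (i - a) + CARD('x)) :: rat) gchoose CARD('x)"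
    by (simp only: binomial_gbinomial)
  also have "(of_nat (nat (i - a) + CARD('x)) :: rat) = of_int i + of_nat CARD('x) - of_int a"
    using assms by simp
  finally show ?thesis .
qed

lemma gbinomial_of_int_in_Ints: "((of_int a :: rat) gchoose m) \<in> \<int>"
proof (cases "a \<ge> 0")
  case True
  then have eq: "(of_int a :: rat) = of_nat (nat a)" by simp
  show ?thesis unfolding eq binomial_gbinomial[symmetric] by (rule Ints_of_nat)
next
  case False
  then have eq: "(of_nat m - of_int a - 1 :: rat) = of_nat (nat (int m - a - 1))" by simp
  have "((of_int a :: rat) gchoose m) = (-1) ^ m * of_nat (nat (int m - a - 1) choose m)"
    unfolding gbinomial_negated_upper[of "of_int a"] eq binomial_gbinomial ..
  then show ?thesis by simp
qed

section \<open>The Hilbert coefficients\<close>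

theorem theorem1p1:
  fixes scale :: "('x::finite, 'k::field) mpoly \<Rightarrow> 'v::ab_group_add \<Rightarrow> 'v"
    and N :: "int \<Rightarrow> 'v set"
    and s i :: nat
    and \<beta> :: "nat \<Rightarrow> nat"
    and d :: "nat \<Rightarrow> int"
  assumes "graded_module scale N"
    and "finitely_generated scale"
    and "\<exists>v::'v. v \<noteq> 0"
    and "cohen_macaulay scale"
    and "krull_dim scale + enat s = enat CARD('x)"
    and "pure_minimal_resolution scale N s \<beta> d"
    and "d 0 = 0"
    and "i \<le> CARD('x) - s"
  shows "(of_int (hilbert_coeff scale N i) :: rat) =
    of_nat (\<beta> 0) * ((\<Prod>j=1..s. of_int (d j)) / fact (s + i)) *
    (\<Sum>js | length js = i \<and> sorted js \<and> set js \<subseteq> {1..s}.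
       \<Prod>k=1..i. of_int (d (js ! (k - 1)) - (int (js ! (k - 1)) + int k - 1)))"
proof -
  note gr = assms(1) and res = assms(6)
  define n where "n = CARD('x)"
  obtain D where D: "krull_dim scale = enat D" "D + s = n"
    using assms(5) by (cases "krull_dim scale") (auto simp: n_def)
  obtain \<epsilon> :: "(nat \<Rightarrow> ('x, 'k) mpoly) \<Rightarrow> 'v" where
    h: "graded_hom (\<beta> 0) 0 scale N \<epsilon>" and surj: "\<epsilon> ` free_module (\<beta> 0) = UNIV"
  proof (rule pure_resolution_maps[OF res])
    fix \<epsilon> :: "(nat \<Rightarrow> ('x, 'k) mpoly) \<Rightarrow> 'v"
    assume "graded_hom (\<beta> 0) (d 0) scale N \<epsilon>" "\<epsilon> ` free_module (\<beta> 0) = UNIV"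
    then show thesis using that[of \<epsilon>] assms(7) by simp
  qed
  define w :: "nat \<Rightarrow> rat" where "w k = (-1) ^ k * of_nat (\<beta> k)" for k
  define a where "a m = (\<Sum>k\<le>s. w k * (of_int (d k) gchoose m))" for m
  define P where "P = (\<Sum>r\<le>n. smult ((-1) ^ (n - r) * a (n - r)) (binom_poly r))"
  have polyP: "poly P x = (\<Sum>k\<le>s. w k * (x + of_nat n - of_int (d k) gchoose n))" for x
  proof -
    have "poly P x = (\<Sum>m\<le>n. (-1) ^ m * a m * (x + of_nat (n - m) gchoose (n - m)))"
      unfolding P_def poly_sum poly_smult poly_binom_poly
      by (rule sum.reindex_bij_witness[of _ "\<lambda>m. n - m" "\<lambda>r. n - r"]) auto
    also have "\<dots> = (\<Sum>k\<le>s. \<Sum>m\<le>n. w k * ((-1) ^ m * (of_int (d k) gchoose m) * (x + of_nat (n - m) gchoose (n - m))))"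
      unfolding a_def sum_distrib_left sum_distrib_right
      by (subst sum.swap) (simp only: mult_ac)
    also have "\<dots> = (\<Sum>k\<le>s. w k * (x + of_nat n - of_int (d k) gchoose n))"
      by (simp add: gbinomial_shift_expansion[of x n] flip: sum_distrib_left)
    finally show ?thesis .
  qed
  \<comment> \<open>Summation starts at \<open>L\<close>, below every shift, so that no degree of any free module is missed.\<close>
  define L where "L = Min (insert 0 (d ` {..s}))"
  have L: "L \<le> 0" "k \<le> s \<Longrightarrow> L \<le> d k" for k
    unfolding L_def by (auto intro!: Min_le simp del: Min_insert)
  define U where "U = Max (insert 0 (d ` {..s}))"
  have U: "0 \<le> U" "k \<le> s \<Longrightarrow> d k \<le> U" for k
    unfolding U_def by (auto intro!: Max_ge simp del: Max_insert)
  have hilbert: "of_nat (hilbert_sum scale N j) = poly P (of_int j)" if "U \<le> j" for j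
  proof -
    have "int (hilbert_sum scale N j) = (\<Sum>l=L..j. \<Sum>k\<le>s. (-1) ^ k * int (\<beta> k) * int (hilb TYPE('x) (l - d k)))"
      by (subst hilbert_sum_eq_sum_interval[OF gr graded_part_negative[OF gr h surj] L(1)])
         (simp_all add: dim_graded_part[OF gr res])
    also have "\<dots> = (\<Sum>k\<le>s. (-1) ^ k * int (\<beta> k) * int (\<Sum>l=L..j. hilb TYPE('x) (l - d k)))"
      by (subst sum.swap) (simp add: sum_distrib_left)
    finally have "(of_int (int (hilbert_sum scale N j)) :: rat) =
       of_int (\<Sum>k\<le>s. (-1) ^ k * int (\<beta> k) * int (\<Sum>l=L..j. hilb TYPE('x) (l - d k)))" by (rule arg_cong)
    then have "of_nat (hilbert_sum scale N j) = (\<Sum>k\<le>s. w k * of_nat (\<Sum>l=L..j. hilb TYPE('x) (l - d k)))"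
      by (simp add: w_def)
    also have "\<dots> = (\<Sum>k\<le>s. w k * (of_int j + of_nat n - of_int (d k) gchoose n))"
    proof (rule sum.cong)
      fix k assume "k \<in> {..s}"
      then have "L \<le> d k" "d k \<le> j" using L U that by (auto intro: order_trans)
      from sum_hilb[OF this, where 'x = 'x]
      show "w k * of_nat (\<Sum>l=L..j. hilb TYPE('x) (l - d k)) = w k * (of_int j + of_nat n - of_int (d k) gchoose n)"
        by (simp add: n_def)
    qed simp
    finally show ?thesis by (simp add: polyP)
  qed
  have hp: "hilbert_poly scale N = P" unfolding hilbert_poly_def
  proof (rule the_equality)
    show ev: "\<forall>\<^sub>F j in at_top. of_nat (hilbert_sum scale N j) = poly P (of_int j)"
      using hilbert unfolding eventually_at_top_linorder by blast
    fix Q :: "rat poly" assume "\<forall>\<^sub>F j in at_top. of_nat (hilbert_sum scale N j) = poly Q (of_int j)"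
    with ev have "\<forall>\<^sub>F j in at_top. poly Q (of_int j) = poly P (of_int j)"
      by eventually_elim simp
    then show "Q = P" by (rule rat_poly_eq_of_eventually)
  qed
  obtain C where C: "\<And>j. hilbert_sum scale N (int j) \<le> C * (j + 1) ^ D"
    using hilbert_sum_growth[OF gr h surj D(1)] by blast
  have "degree P \<le> D"
  proof (rule degree_le_of_growth)
    fix j assume "nat U \<le> j"
    then have "poly P (of_nat j) = of_nat (hilbert_sum scale N (int j))" using hilbert[of "int j"] by simp
    moreover have "(of_nat (hilbert_sum scale N (int j)) :: rat) \<le> of_nat (C * (j + 1) ^ D)" using C[of j] by (simp only: of_nat_le_iff)
    ultimately show "0 \<le> poly P (of_nat j) \<and> poly P (of_nat j) \<le> of_nat C * (of_nat j + 1) ^ D" by (simp add: add.commute)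
  qed
  then have coeffP: "coeff P k = 0" if "Suc D \<le> k" for k using that by (intro coeff_eq_0) simp
  \<comment> \<open>The Herzog-Kuehl equations.\<close>
  have vanish: "a m = 0" if "m < s" for m
  proof -
    have "(-1) ^ (n - (n - m)) * a (n - (n - m)) = 0"
      by (rule binom_poly_coefficients_vanish[OF coeffP[unfolded P_def]]) (use that D in auto)
    then show ?thesis using that D by simp
  qed
  have a_Ints: "a m \<in> \<int>" for m
    unfolding a_def w_def by (intro Ints_sum Ints_mult gbinomial_of_int_in_Ints) auto
  \<comment> \<open>The floor only converts the type: the argument is an integer.\<close>
  define e :: "nat \<Rightarrow> int" where "e l = (if l \<le> D then \<lfloor>(-1) ^ s * a (s + l)\<rfloor> else 0)" for l
  have e: "of_int (e l) = (-1) ^ s * a (s + l)" if "l \<le> D" for l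
    using that a_Ints[of "s + l"] by (simp add: e_def Ints_mult of_int_floor)
  have P_e: "P = (\<Sum>r\<le>D. smult ((-1) ^ (D - r) * of_int (e (D - r))) (binom_poly r))"
  proof -
    have "P = (\<Sum>r\<le>D. smult ((-1) ^ (n - r) * a (n - r)) (binom_poly r))"
      unfolding P_def by (rule sum.mono_neutral_right) (use D vanish in auto)
    also have "\<dots> = (\<Sum>r\<le>D. smult ((-1) ^ (D - r) * of_int (e (D - r))) (binom_poly r))"
    proof (rule sum.cong)
      fix r assume "r \<in> {..D}"
      then have nr: "n - r = s + (D - r)" using D by simp
      show "smult ((-1) ^ (n - r) * a (n - r)) (binom_poly r) = smult ((-1) ^ (D - r) * of_int (e (D - r))) (binom_poly r)"
        unfolding nr by (simp add: e power_add mult_ac)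
    qed simp
    finally show ?thesis .
  qed
  have expand: "(\<Sum>l\<le>D. (-1) ^ l * of_int (f l) * (x + of_nat (D - l) gchoose (D - l)))
      = poly (\<Sum>r\<le>D. smult ((-1) ^ (D - r) * of_int (f (D - r))) (binom_poly r)) x" for f :: "nat \<Rightarrow> int" and x :: rat
    unfolding poly_sum poly_smult poly_binom_poly
    by (rule sum.reindex_bij_witness[of _ "\<lambda>r. D - r" "\<lambda>l. D - l"]) auto
  have "hilbert_coeff scale N = e"
    unfolding hilbert_coeff_def D(1) the_enat.simps Let_def hp
  proof (rule the_equality)
    show "(\<forall>l>D. e l = 0) \<and> (\<forall>x. poly P x = (\<Sum>l\<le>D. (-1) ^ l * of_int (e l) * (x + of_nat (D - l) gchoose (D - l))))"
      unfolding expand P_e[symmetric] by (simp add: e_def)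
    fix f :: "nat \<Rightarrow> int"
    assume f: "(\<forall>l>D. f l = 0) \<and> (\<forall>x. poly P x = (\<Sum>l\<le>D. (-1) ^ l * of_int (f l) * (x + of_nat (D - l) gchoose (D - l))))"
    then have "P = (\<Sum>r\<le>D. smult ((-1) ^ (D - r) * of_int (f (D - r))) (binom_poly r))"
      unfolding expand poly_eq_poly_eq_iff[symmetric] by blast
    then have "(\<Sum>r\<le>D. smult ((-1) ^ (D - r) * of_int (f (D - r)) - (-1) ^ (D - r) * of_int (e (D - r))) (binom_poly r)) = 0"
      using P_e by (simp add: smult_diff_left sum_subtractf)
    then have z: "(-1) ^ (D - r) * of_int (f (D - r)) - (-1) ^ (D - r) * of_int (e (D - r)) = (0::rat)" if "r \<le> D" for r
      using binom_poly_coefficients_vanish[where D = 0 and n = D and r = r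
          and c = "\<lambda>r. (-1) ^ (D - r) * of_int (f (D - r)) - (-1) ^ (D - r) * of_int (e (D - r))"] that
      by simp
    show "f = e"
    proof
      fix l
      show "f l = e l" using z[of "D - l"] f by (cases "l \<le> D") (auto simp: e_def)
    qed
  qed
  then have "(of_int (hilbert_coeff scale N i) :: rat) = (-1) ^ s * a (s + i)"
    using e[of i] assms(8) D by (simp add: n_def)
  also have "a (s + i) = (-1) ^ s * w 0 * (\<Prod>j=1..s. of_int (d j)) / fact (s + i) * shifted_sum d i s"
    unfolding a_def by (rule falling_factorial_moment[where d = d, OF assms(7)]) (rule vanish[unfolded a_def])
  also have "(-1) ^ s * ((-1) ^ s * w 0 * (\<Prod>j=1..s. of_int (d j)) / fact (s + i) * shifted_sum d i s)
     = of_nat (\<beta> 0) * ((\<Prod>j=1..s. of_int (d j)) / fact (s + i)) * shifted_sum d i s"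
    by (simp add: w_def)
  finally show ?thesis unfolding shifted_sum_def .
qed

end
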